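(* Let $l,m\in\mathbb{Z}$ and $\alpha\in\{0,1,2,3\}$ such that $l+m\equiv\alpha+1\pmod 2$. Then there exist polynomials $Z_{l,m,\alpha}(p)$ and $D_{l,m,\alpha}(p)$ in $p$ with $$\mathbb{P}(l,m;4p+\alpha)=\frac14+2^{-4p-\alpha}\binom{2p-1}{p}^2\frac{Z_{l,m,\alpha}(p)}{D_{l,m,\alpha}(p)}$$ for $p\in\mathbb{N}$, where $$\deg(Z_{l,m,\alpha})\le\deg(D_{l,m,\alpha})\le\max(|l|,|m|)+\left\lfloor\frac{\min(|l|+3,|m|)}{2}\right\rfloor+1$$ and $D_{l,m,\alpha}(p)$ is explicitly known.
   Context: $\mathbb{N}=\{0,1,2,\dots\}$. The Aztec diamond of size $n$ is the union of all unit squares $[i,i+1]\times[j,j+1]$ ($i,j\in\mathbb{Z}$) contained in $\{(x,y):|x|+|y|\le n+1\}$. Its squares are coloured black and white in a chessboard pattern so that the left one of the topmost squares is black. For $l,m\in\mathbb{Z}$, $\mathbb{P}(l,m;n)$ denotes the probability that a uniformly random domino tiling of the Aztec diamond of size $n$ contains the horizontal domino $[l-1,l+1]\times[m,m+1]$ (the centre of whose lower side is $(l,m)$) with its left square black. "Explicitly known" means that $D_{l,m,\alpha}(p)$ can be written down, for given $l,m,\alpha$, as an explicit product of linear factors of the forms $i+p$ and $2p-2j+1$ with positive integers $i,j$.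
   Formalization: The formula is asserted only for those p for which the domino lies in the Aztec diamond of size 4p+α (outside it the probability is 0 and the formula can fail), and the binomial coefficient binom(2p-1,p) is read as 1/2 at p=0. *)

theory Defs
  imports "HOL-Probability.Probability" "HOL-Number_Theory.Cong"
    "HOL-Computational_Algebra.Polynomial" "HOL-Library.Disjoint_Sets" "HOL-Library.Multiset"
begin

text \<open>A unit square is referred to by the integer coordinates of its lower left corner, and a
  region made of unit squares by the set of its squares.\<close>

definition unit_square :: "int \<times> int \<Rightarrow> (real \<times> real) set" where
  "unit_square = (\<lambda>(i, j). {of_int i .. of_int i + 1} \<times> {of_int j .. of_int j + 1})"

definition aztec_diamond :: "nat \<Rightarrow> (int \<times> int) set" where
  "aztec_diamond n = {c. unit_square c \<subseteq> {(x, y). \<bar>x\<bar> + \<bar>y\<bar> \<le> real n + 1}}"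

text \<open>The topmost squares of the Aztec diamond of size \<open>n \<ge> 1\<close> are \<open>(-1, n - 1)\<close> and
  \<open>(0, n - 1)\<close>; black squares are those of the chessboard colour of \<open>(-1, n - 1)\<close>.\<close>

definition black_square :: "nat \<Rightarrow> int \<times> int \<Rightarrow> bool" where
  "black_square n = (\<lambda>(i, j). [i + j = - 1 + (int n - 1)] (mod 2))"

text \<open>The rectangle \<open>[l - 1, l + 1] \<times> [m, m + 1]\<close>: the centre of its lower side is \<open>(l, m)\<close>.\<close>

definition horizontal_domino :: "int \<Rightarrow> int \<Rightarrow> (int \<times> int) set" where
  "horizontal_domino l m = {(l - 1, m), (l, m)}"

definition vertical_domino :: "int \<Rightarrow> int \<Rightarrow> (int \<times> int) set" where
  "vertical_domino i j = {(i, j), (i, j + 1)}"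

definition dominoes :: "(int \<times> int) set set" where
  "dominoes = {horizontal_domino l m | l m. True} \<union> {vertical_domino i j | i j. True}"

definition domino_tilings :: "(int \<times> int) set \<Rightarrow> (int \<times> int) set set set" where
  "domino_tilings R = {T. partition_on R T \<and> T \<subseteq> dominoes}"

definition placement_prob :: "int \<Rightarrow> int \<Rightarrow> nat \<Rightarrow> real" where
  "placement_prob l m n =
     measure_pmf.prob (pmf_of_set (domino_tilings (aztec_diamond n)))
       {T. horizontal_domino l m \<in> T \<and> black_square n (l - 1, m)}"

text \<open>The binomial coefficient \<open>2p - 1\<close> over \<open>p\<close>. For \<open>p = 0\<close> it is read as \<open>1/2\<close>, so that
  it equals one half of the central binomial coefficient \<open>2p\<close> over \<open>p\<close> for every \<open>p\<close>; this
  is also the limit of \<open>\<Gamma>(2p) / (\<Gamma>(p + 1) \<Gamma>(p))\<close> for \<open>p \<rightarrow> 0\<close>. With the value \<open>1\<close> (which is what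
  \<open>choose\<close> and \<open>gchoose\<close> give) the formula for the placement probabilities fails at
  \<open>p = 0\<close>, for instance for \<open>l = m = 0\<close> and size \<open>1\<close>.\<close>

definition half_central_binomial :: "nat \<Rightarrow> real" where
  "half_central_binomial p = (if p = 0 then 1 / 2 else real ((2 * p - 1) choose p))"

text \<open>Products of linear factors \<open>i + p\<close> and \<open>2p - 2j + 1\<close> with positive integers \<open>i\<close>, \<open>j\<close>,
  as polynomials in \<open>p\<close>. Factors may be repeated.\<close>

definition explicit_product :: "real poly \<Rightarrow> bool" where
  "explicit_product D \<longleftrightarrow>
     (\<exists>I J :: nat multiset. (\<forall>i\<in>#I. i \<ge> 1) \<and> (\<forall>j\<in>#J. j \<ge> 1) \<and>
        D = (\<Prod>i\<in>#I. [:real i, 1:]) * (\<Prod>j\<in>#J. [:1 - 2 * real j, 2:]))"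

end

theory Submission
  imports Defs
begin

text \<open>The proof has three parts: a probabilistic one that turns placement probabilities into sums of
explicit numbers along a line, an identity that makes these sums finite in a sense uniform in the
size, and an arithmetic one that counts the linear factors in the denominators.

\<^emph>\<open>Shuffling.\<close> Colour the lattice points like a chessboard. The 2 by 2 blocks around the points of
one colour cover the diamond of size \<open>n + 1\<close>, and each domino is a side of exactly one block. In
each block replace the covered squares of a tiling of the diamond of size \<open>n\<close> by the uncovered
ones. Since a square of the larger diamond lies in two blocks if it belongs to the smaller diamond
and in one otherwise, this is a bijection between the ways in which the blocks can be covered by
tilings of the two diamonds (\<open>covers_complement\<close>). A single domino moves to the opposite side of
its block, a full block becomes empty, and an empty block becomes full in one of two ways; so the
number of tilings with a given cover changes by a factor that is the same for all covers
(\<open>shuffling\<close>). For the probabilities this means that the probability of a side at size \<open>n + 1\<close> is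
the probability of the opposite side at size \<open>n\<close>, plus half of the net creation rate, which is one
minus the expected number of sides of the block that occur at size \<open>n\<close> (\<open>domino_prob_shuffle\<close>).

\<^emph>\<open>Creation rates.\<close> Summing that recursion expresses the placement probability as half of \<open>flow\<close>,
the sum of the creation rates along the line on which the domino travels. The creation rates have
the generating function \<open>1 / (1 - (x + 1/x + y + 1/y) z / 2 + z\<^sup>2)\<close>, and the denominator is half of
\<open>A + B\<close> with \<open>A = (1 - x z) (1 - z / x)\<close> and \<open>B = (1 - y z) (1 - z / y)\<close>. Hence
\<open>C / A + C / B = 2 / (A B)\<close> for the generating function \<open>C\<close>: the flows of horizontal
and of vertical dominoes add up to a constant inside the diamond (\<open>two_way_flow_total\<close>).

\<^emph>\<open>Finitely many rates.\<close> At the centre this constant and the symmetry of the four directions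
determine the flow: it is \<open>1 / 2\<close> plus half of one creation rate. Moving along the vertical axis costs
finitely many rates, the same constant takes us from the vertical to the horizontal axis, and from there
one moves vertically to \<open>(l, m)\<close>. So the flow is \<open>1 / 2\<close> plus a combination of creation rates whose
positions and times, relative to the size, depend on \<open>l\<close> and \<open>m\<close> only (\<open>flow_axis\<close>,
\<open>flow_descend\<close>). This is where the main term \<open>1 / 4\<close> comes from.

\<^emph>\<open>Denominators.\<close> A creation rate is a product of two coefficients of polynomials
\<open>(1 + z)\<^sup>i (1 - z)\<^sup>j\<close> (\<open>creation_krawtchouk\<close>). Near the centre such a polynomial is an even power of
\<open>1 - z\<^sup>2\<close> times a polynomial that does not depend on \<open>p\<close>, so the coefficient is a fixed combination
of binomial coefficients close to a central one, and their ratios to \<open>half_central_binomial p\<close> are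
rational functions of \<open>p\<close> with denominators of the required form
(\<open>even_power_coeff_rational\<close>). Counting the factors needed for all rates that occur gives the
bound on the degree (\<open>flow_rational\<close>).\<close>

section \<open>Blocks of the Aztec diamond\<close>

text \<open>A unit square lies in the diamond iff its corner farthest from the origin does, and twice the
  coordinates of that corner are \<open>\<bar>2 * i + 1\<bar> + 1\<close> and \<open>\<bar>2 * j + 1\<bar> + 1\<close> in absolute value.\<close>

lemma aztec_diamond_iff: "(i, j) \<in> aztec_diamond n \<longleftrightarrow> \<bar>2 * i + 1\<bar> + \<bar>2 * j + 1\<bar> \<le> 2 * int n"
proof
  assume "(i, j) \<in> aztec_diamond n"
  then have sub: "(x, y) \<in> unit_square (i, j) \<Longrightarrow> \<bar>x\<bar> + \<bar>y\<bar> \<le> real n + 1" for x y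
    by (auto simp: aztec_diamond_def)
  have "\<bar>real_of_int (i + a)\<bar> + \<bar>real_of_int (j + b)\<bar> \<le> real n + 1" if "a \<in> {0, 1}" "b \<in> {0, 1}" for a b
    using that by (intro sub) (auto simp: unit_square_def)
  then have "real_of_int (\<bar>i + a\<bar> + \<bar>j + b\<bar>) \<le> real_of_int (int n + 1)" if "a \<in> {0, 1}" "b \<in> {0, 1}" for a b
    using that by simp
  then have "\<bar>i + a\<bar> + \<bar>j + b\<bar> \<le> int n + 1" if "a \<in> {0, 1}" "b \<in> {0, 1}" for a b
    using that by (simp only: of_int_le_iff)
  from this[of 0 0] this[of 0 1] this[of 1 0] this[of 1 1]
  show "\<bar>2 * i + 1\<bar> + \<bar>2 * j + 1\<bar> \<le> 2 * int n"
    by (cases "0 \<le> i"; cases "0 \<le> j"; simp)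
next
  assume le: "\<bar>2 * i + 1\<bar> + \<bar>2 * j + 1\<bar> \<le> 2 * int n"
  have "\<bar>x\<bar> + \<bar>y\<bar> \<le> real n + 1" if "(x, y) \<in> unit_square (i, j)" for x y
  proof -
    have "2 * \<bar>x\<bar> \<le> \<bar>real_of_int (2 * i + 1)\<bar> + 1" "2 * \<bar>y\<bar> \<le> \<bar>real_of_int (2 * j + 1)\<bar> + 1"
      using that by (auto simp: unit_square_def abs_if)
    moreover have "real_of_int (\<bar>2 * i + 1\<bar> + \<bar>2 * j + 1\<bar>) \<le> real_of_int (2 * int n)"
      using le by (simp only: of_int_le_iff)
    ultimately show ?thesis by simp
  qed
  then show "(i, j) \<in> aztec_diamond n" by (auto simp: aztec_diamond_def)
qed

lemma finite_aztec_diamond: "finite (aztec_diamond n)"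
proof (rule finite_subset)
  show "aztec_diamond n \<subseteq> {- int n - 1..int n} \<times> {- int n - 1..int n}"
    by (auto simp: aztec_diamond_iff)
qed auto

lemma aztec_diamond_mono: "aztec_diamond n \<subseteq> aztec_diamond (Suc n)"
  by (auto simp: aztec_diamond_iff)

text \<open>The centres of the blocks by which a tiling of the diamond of size \<open>n\<close> is cut up. The parity is
  the one for which the topmost squares form the upper half of a block.\<close>

definition centres :: "nat \<Rightarrow> (int \<times> int) set" where
  "centres n = {(l, m). \<bar>l\<bar> + \<bar>m\<bar> < int n \<and> odd (l + m + int n)}"

fun block :: "int \<times> int \<Rightarrow> (int \<times> int) set" where
  "block (l, m) = {(l - 1, m - 1), (l, m - 1), (l - 1, m), (l, m)}"

fun top_side :: "int \<times> int \<Rightarrow> (int \<times> int) set" where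
  "top_side (l, m) = horizontal_domino l m"

fun bottom_side :: "int \<times> int \<Rightarrow> (int \<times> int) set" where
  "bottom_side (l, m) = horizontal_domino l (m - 1)"

fun left_side :: "int \<times> int \<Rightarrow> (int \<times> int) set" where
  "left_side (l, m) = vertical_domino (l - 1) (m - 1)"

fun right_side :: "int \<times> int \<Rightarrow> (int \<times> int) set" where
  "right_side (l, m) = vertical_domino l (m - 1)"

definition sides :: "int \<times> int \<Rightarrow> (int \<times> int) set set" where
  "sides \<beta> = {top_side \<beta>, bottom_side \<beta>, left_side \<beta>, right_side \<beta>}"

lemmas side_squares = horizontal_domino_def vertical_domino_def

lemma finite_block: "finite (block \<beta>)"
  by (cases \<beta>) simp

lemma finite_sides: "finite (sides \<beta>)"
  by (simp add: sides_def)

lemma finite_centres: "finite (centres n)"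
proof (rule finite_subset)
  show "centres n \<subseteq> {- int n..int n} \<times> {- int n..int n}"
    by (auto simp: centres_def)
qed auto

lemma sides_dominoes: "sides \<beta> \<subseteq> dominoes"
  by (cases \<beta>) (auto simp: sides_def dominoes_def)

lemma side_subset_block: "d \<in> sides \<beta> \<Longrightarrow> d \<subseteq> block \<beta>"
  by (cases \<beta>) (auto simp: sides_def side_squares)

lemma domino_eq_iff:
  "horizontal_domino l m = horizontal_domino l' m' \<longleftrightarrow> l = l' \<and> m = m'"
  "vertical_domino l m = vertical_domino l' m' \<longleftrightarrow> l = l' \<and> m = m'"
  "horizontal_domino l m \<noteq> vertical_domino l' m'"
  "vertical_domino l m \<noteq> horizontal_domino l' m'"
  by (auto simp: side_squares doubleton_eq_iff)

lemma side_unique: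
  assumes "d \<in> sides (l, m)" "d \<in> sides (l', m')" "even (l + m + (l' + m'))"
  shows "(l, m) = (l', m')"
  using assms by (auto simp: sides_def domino_eq_iff)

lemma centres_side_unique:
  assumes "d \<in> sides \<beta>" "d \<in> sides \<gamma>" "\<beta> \<in> centres n" "\<gamma> \<in> centres n"
  shows "\<beta> = \<gamma>"
proof -
  obtain l m l' m' where eq: "\<beta> = (l, m)" "\<gamma> = (l', m')" by fastforce
  have "even (l + m + (l' + m'))" using assms(3,4) unfolding eq centres_def by auto
  then show ?thesis using side_unique assms(1,2) unfolding eq by blast
qed

text \<open>The midpoints of the two long sides of a horizontal domino have different parities, so exactly one of
  them can be a centre; the parity also improves the bound that the diamond gives by one.\<close>

lemma nearest_centre:
  fixes l m N :: int
  assumes "\<bar>2 * l - 1\<bar> + \<bar>2 * m + 1\<bar> \<le> 2 * N + 2" "\<bar>2 * l + 1\<bar> + \<bar>2 * m + 1\<bar> \<le> 2 * N + 2"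
  shows "\<bar>l\<bar> + \<bar>m\<bar> \<le> N \<and> even (l + m + N) \<or> \<bar>l\<bar> + \<bar>m + 1\<bar> \<le> N \<and> odd (l + m + N)"
proof (cases "even (l + m + N)")
  case True
  have "\<bar>l\<bar> + \<bar>m\<bar> \<le> N + 1" using assms by linarith
  moreover have "\<bar>l\<bar> + \<bar>m\<bar> \<noteq> N + 1"
  proof
    assume "\<bar>l\<bar> + \<bar>m\<bar> = N + 1"
    then have "even (\<bar>l\<bar> + \<bar>m\<bar> + N + 1)" by simp
    then show False using True by simp
  qed
  ultimately show ?thesis using True by simp
next
  case False
  have "\<bar>l\<bar> + \<bar>m + 1\<bar> \<le> N + 1" using assms by linarith
  moreover have "\<bar>l\<bar> + \<bar>m + 1\<bar> \<noteq> N + 1"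
  proof
    assume "\<bar>l\<bar> + \<bar>m + 1\<bar> = N + 1"
    then have "even (\<bar>l\<bar> + \<bar>m + 1\<bar> + N + 1)" by simp
    then show False using False by (cases "even l") auto
  qed
  ultimately show ?thesis using False by simp
qed

lemma domino_is_side:
  assumes "d \<in> dominoes" "d \<subseteq> aztec_diamond (Suc n)"
  shows "\<exists>\<beta>\<in>centres (Suc n). d \<in> sides \<beta>"
proof -
  consider l m where "d = horizontal_domino l m" | l m where "d = vertical_domino l m"
    using assms(1) by (auto simp: dominoes_def)
  then show ?thesis
  proof cases
    case (1 l m)
    then have "d = top_side (l, m)" "d = bottom_side (l, m + 1)" by simp_all
    moreover have "(l, m) \<in> centres (Suc n) \<or> (l, m + 1) \<in> centres (Suc n)"
      using assms(2) nearest_centre[of l m "int n"] unfolding 1 side_squares centres_def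
      by (auto simp: aztec_diamond_iff algebra_simps)
    ultimately show ?thesis unfolding sides_def by blast
  next
    case (2 l m)
    then have "d = right_side (l, m + 1)" "d = left_side (l + 1, m + 1)" by simp_all
    moreover have "(l, m + 1) \<in> centres (Suc n) \<or> (l + 1, m + 1) \<in> centres (Suc n)"
      using assms(2) nearest_centre[of "m + 1" l "int n"] unfolding 2 side_squares centres_def
      by (auto simp: aztec_diamond_iff algebra_simps)
    ultimately show ?thesis unfolding sides_def by blast
  qed
qed

lemma card_filter_pair:
  "a \<noteq> b \<Longrightarrow> card {x \<in> {a, b}. P x} = of_bool (P a) + of_bool (P b)"
proof -
  assume "a \<noteq> b"
  have "{x \<in> {a, b}. P x} = (if P a then {a} else {}) \<union> (if P b then {b} else {})" by auto
  then show ?thesis using \<open>a \<noteq> b\<close> by simp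
qed

text \<open>A square lies in the two blocks around its corners of the right parity, which are opposite corners.
  Both corners are centres iff the square belongs to the smaller diamond, and at least one is iff it
  belongs to the larger.\<close>

lemma diagonal_centres_count:
  fixes i j N :: int
  assumes "even (i + j + N)"
  shows "of_bool (\<bar>i\<bar> + \<bar>j\<bar> \<le> N) + of_bool (\<bar>i + 1\<bar> + \<bar>j + 1\<bar> \<le> N)
    = (of_bool (\<bar>2 * i + 1\<bar> + \<bar>2 * j + 1\<bar> \<le> 2 * (N + 1)) + of_bool (\<bar>2 * i + 1\<bar> + \<bar>2 * j + 1\<bar> \<le> 2 * N) :: nat)"
proof -
  obtain h where "i + j + N = 2 * h" using assms by (rule evenE)
  then have N: "N = 2 * h - i - j" by simp
  show ?thesis unfolding N
    by (cases "0 \<le> i"; cases "0 \<le> j"; auto simp: of_bool_def; presburger)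
qed

text \<open>This count is the reason for shuffling to work: replacing covered by uncovered squares in every
  block turns the covering multiplicity 1 on the smaller diamond into multiplicity 1 on the larger.\<close>

lemma blocks_at_square:
  "card {\<beta> \<in> centres (Suc n). c \<in> block \<beta>}
    = of_bool (c \<in> aztec_diamond (Suc n)) + of_bool (c \<in> aztec_diamond n)"
proof -
  obtain i j where c: "c = (i, j)" by fastforce
  show ?thesis
  proof (cases "even (i + j + int n)")
    case True
    have "{\<beta> \<in> centres (Suc n). c \<in> block \<beta>}
      = {\<beta> \<in> {(i, j), (i + 1, j + 1)}. \<bar>fst \<beta>\<bar> + \<bar>snd \<beta>\<bar> \<le> int n}"
      using True unfolding c centres_def by auto
    also have "card \<dots> = of_bool (\<bar>i\<bar> + \<bar>j\<bar> \<le> int n) + of_bool (\<bar>i + 1\<bar> + \<bar>j + 1\<bar> \<le> int n)"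
      by (subst card_filter_pair) auto
    also have "\<dots> = of_bool (\<bar>2 * i + 1\<bar> + \<bar>2 * j + 1\<bar> \<le> 2 * (int n + 1)) + of_bool (\<bar>2 * i + 1\<bar> + \<bar>2 * j + 1\<bar> \<le> 2 * int n)"
      using True by (intro diagonal_centres_count) auto
    finally show ?thesis unfolding c aztec_diamond_iff by (simp add: add.commute)
  next
    case False
    have "{\<beta> \<in> centres (Suc n). c \<in> block \<beta>}
      = {\<beta> \<in> {(i + 1, j), (i, j + 1)}. \<bar>fst \<beta>\<bar> + \<bar>snd \<beta>\<bar> \<le> int n}"
      using False unfolding c centres_def by auto
    also have "card \<dots> = of_bool (\<bar>i + 1\<bar> + \<bar>j\<bar> \<le> int n) + of_bool (\<bar>i\<bar> + \<bar>j + 1\<bar> \<le> int n)"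
      by (subst card_filter_pair) auto
    also have "\<dots> = of_bool (\<bar>2 * i + 1\<bar> + \<bar>2 * j + 1\<bar> \<le> 2 * (int n + 1)) + of_bool (\<bar>2 * i + 1\<bar> + \<bar>2 * j + 1\<bar> \<le> 2 * int n)"
    proof -
      have refl: "\<bar>- j - 1\<bar> = \<bar>j + 1\<bar>" "\<bar>- j - 1 + 1\<bar> = \<bar>j\<bar>" "\<bar>2 * (- j - 1) + 1\<bar> = \<bar>2 * j + 1\<bar>"
        by (auto simp: abs_if)
      have "even (i + (- j - 1) + int n)" using False by auto
      from diagonal_centres_count[OF this, unfolded refl] show ?thesis by (simp only: add.commute)
    qed
    finally show ?thesis unfolding c aztec_diamond_iff by (simp add: add.commute)
  qed
qed

section \<open>Domino shuffling\<close>

text \<open>A tiling seen block by block: a choice of disjoint sides in every block that together cover the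
  squares of \<open>V\<close> once and no others.\<close>

definition configurations :: "nat \<Rightarrow> (int \<times> int) set \<Rightarrow> (int \<times> int \<Rightarrow> (int \<times> int) set set) set" where
  "configurations n V = {s \<in> (\<Pi>\<^sub>E \<beta>\<in>centres n. {t. t \<subseteq> sides \<beta> \<and> disjoint t}).
     \<forall>c. card {\<beta> \<in> centres n. c \<in> \<Union>(s \<beta>)} = of_bool (c \<in> V)}"

text \<open>The possible families of sets of covered squares when the squares of \<open>V\<close> are distributed over the
  blocks.\<close>

definition covers :: "nat \<Rightarrow> (int \<times> int) set \<Rightarrow> (int \<times> int \<Rightarrow> (int \<times> int) set) set" where
  "covers n V = {X \<in> (\<Pi>\<^sub>E \<beta>\<in>centres n. Pow (block \<beta>)).
     \<forall>c. card {\<beta> \<in> centres n. c \<in> X \<beta>} = of_bool (c \<in> V)}"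

lemma tiling_configuration_bij:
  assumes "V \<subseteq> aztec_diamond (Suc n)"
  shows "bij_betw (\<lambda>T. \<lambda>\<beta>\<in>centres (Suc n). T \<inter> sides \<beta>) (domino_tilings V) (configurations (Suc n) V)"
proof (rule bij_betw_byWitness[where f' = "\<lambda>s. \<Union>\<beta>\<in>centres (Suc n). s \<beta>"])
  let ?C = "centres (Suc n)"
  have side: "\<exists>\<beta>\<in>?C. d \<in> sides \<beta>" if "T \<in> domino_tilings V" "d \<in> T" for T d
    using that assms by (intro domino_is_side) (auto simp: domino_tilings_def partition_on_def)
  show "\<forall>T\<in>domino_tilings V. (\<Union>\<beta>\<in>?C. (\<lambda>\<beta>\<in>?C. T \<inter> sides \<beta>) \<beta>) = T"
    using side by fastforce
  have local_glue: "(\<Union>\<gamma>\<in>?C. s \<gamma>) \<inter> sides \<beta> = s \<beta>"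
    if "s \<in> configurations (Suc n) V" "\<beta> \<in> ?C" for s \<beta>
  proof -
    have "s \<gamma> \<subseteq> sides \<gamma>" if "\<gamma> \<in> ?C" for \<gamma>
      using \<open>s \<in> configurations (Suc n) V\<close> that by (auto simp: configurations_def PiE_iff)
    then show ?thesis using that(2) centres_side_unique by blast
  qed
  show "\<forall>s\<in>configurations (Suc n) V. (\<lambda>\<beta>\<in>?C. (\<Union>\<gamma>\<in>?C. s \<gamma>) \<inter> sides \<beta>) = s"
  proof
    fix s assume s: "s \<in> configurations (Suc n) V"
    then have "s \<in> extensional ?C" by (auto simp: configurations_def PiE_def)
    then show "(\<lambda>\<beta>\<in>?C. (\<Union>\<gamma>\<in>?C. s \<gamma>) \<inter> sides \<beta>) = s"
      using local_glue[OF s] by (intro extensionalityI[of _ ?C]) auto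
  qed
  show "(\<lambda>T. \<lambda>\<beta>\<in>?C. T \<inter> sides \<beta>) ` domino_tilings V \<subseteq> configurations (Suc n) V"
  proof
    fix s assume "s \<in> (\<lambda>T. \<lambda>\<beta>\<in>?C. T \<inter> sides \<beta>) ` domino_tilings V"
    then obtain T where T: "T \<in> domino_tilings V" and s: "s = (\<lambda>\<beta>\<in>?C. T \<inter> sides \<beta>)" by blast
    have part: "\<Union>T = V" "disjoint T" using T by (auto simp: domino_tilings_def partition_on_def)
    have "card {\<beta> \<in> ?C. c \<in> \<Union>(T \<inter> sides \<beta>)} = of_bool (c \<in> V)" for c
    proof (cases "c \<in> V")
      case True
      then obtain d where d: "d \<in> T" "c \<in> d" using part by blast
      obtain \<beta> where \<beta>: "\<beta> \<in> ?C" "d \<in> sides \<beta>" using side[OF T d(1)] by blast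
      have "d' = d" if "d' \<in> T" "c \<in> d'" for d'
        using part(2) that d unfolding disjoint_def by blast
      then have "{\<beta> \<in> ?C. c \<in> \<Union>(T \<inter> sides \<beta>)} = {\<beta>}"
        using d \<beta> centres_side_unique by blast
      then show ?thesis using True by simp
    next
      case False
      then have "{\<beta> \<in> ?C. c \<in> \<Union>(T \<inter> sides \<beta>)} = {}" using part by blast
      then show ?thesis using False by (simp only: card.empty) simp
    qed
    then have "card {\<beta> \<in> ?C. c \<in> \<Union>(s \<beta>)} = of_bool (c \<in> V)" for c
      unfolding s by (simp cong: conj_cong)
    moreover have "disjoint (T \<inter> sides \<beta>)" for \<beta>
      using part(2) unfolding disjoint_def by blast
    ultimately show "s \<in> configurations (Suc n) V"
      unfolding configurations_def s by (auto simp: PiE_iff)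
  qed
  show "(\<lambda>s. \<Union>\<beta>\<in>?C. s \<beta>) ` configurations (Suc n) V \<subseteq> domino_tilings V"
  proof
    fix T assume "T \<in> (\<lambda>s. \<Union>\<beta>\<in>?C. s \<beta>) ` configurations (Suc n) V"
    then obtain s where s: "s \<in> configurations (Suc n) V" and T: "T = (\<Union>\<beta>\<in>?C. s \<beta>)" by blast
    have sub: "s \<beta> \<subseteq> sides \<beta>" "disjoint (s \<beta>)" if "\<beta> \<in> ?C" for \<beta>
      using s that by (auto simp: configurations_def PiE_iff)
    have count: "card {\<beta> \<in> ?C. c \<in> \<Union>(s \<beta>)} = of_bool (c \<in> V)" for c
      using s unfolding configurations_def by blast
    have fin: "finite {\<beta> \<in> ?C. c \<in> \<Union>(s \<beta>)}" for c using finite_centres by simp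
    have "c \<in> \<Union>T \<longleftrightarrow> c \<in> V" for c
    proof -
      have "c \<in> \<Union>T \<longleftrightarrow> {\<beta> \<in> ?C. c \<in> \<Union>(s \<beta>)} \<noteq> {}" unfolding T by blast
      also have "\<dots> \<longleftrightarrow> card {\<beta> \<in> ?C. c \<in> \<Union>(s \<beta>)} \<noteq> 0"
        using fin[of c] by (simp only: card_eq_0_iff) simp
      finally show ?thesis unfolding count by simp
    qed
    then have "\<Union>T = V" by blast
    moreover have "disjoint T"
      unfolding disjoint_def
    proof (intro ballI impI)
      fix d d' assume dd: "d \<in> T" "d' \<in> T" "d \<noteq> d'"
      obtain \<beta> \<gamma> where bg: "\<beta> \<in> ?C" "d \<in> s \<beta>" "\<gamma> \<in> ?C" "d' \<in> s \<gamma>" using dd unfolding T by blast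
      show "d \<inter> d' = {}"
      proof (rule ccontr)
        assume "d \<inter> d' \<noteq> {}"
        then obtain c where c: "c \<in> d" "c \<in> d'" by blast
        have "{\<beta>, \<gamma>} \<subseteq> {\<beta> \<in> ?C. c \<in> \<Union>(s \<beta>)}" using bg c by blast
        then have "card {\<beta>, \<gamma>} \<le> of_bool (c \<in> V)"
          unfolding count[symmetric] by (rule card_mono[OF fin])
        then have "\<beta> = \<gamma>" by (auto simp: card_insert_if of_bool_def split: if_splits)
        then show False using sub(2)[OF bg(1)] bg c dd(3) unfolding disjoint_def by blast
      qed
    qed
    moreover have "T \<subseteq> dominoes" unfolding T using sub(1) sides_dominoes by blast
    moreover have "{} \<notin> dominoes" by (auto simp: dominoes_def side_squares)
    ultimately show "T \<in> domino_tilings V"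
      by (auto simp: domino_tilings_def partition_on_def)
  qed
qed

text \<open>The total weight of the ways to fill exactly the squares \<open>Y\<close> of a block by sides of the block.\<close>

definition cover_weight :: "((int \<times> int) set set \<Rightarrow> real) \<Rightarrow> int \<times> int \<Rightarrow> (int \<times> int) set \<Rightarrow> real" where
  "cover_weight g \<beta> Y = (\<Sum>t\<in>{t. t \<subseteq> sides \<beta> \<and> disjoint t \<and> \<Union>t = Y}. g t)"

lemma finite_covers: "finite (covers n V)"
  unfolding covers_def
  by (rule finite_subset[OF _ finite_PiE[of "centres n" "\<lambda>\<beta>. Pow (block \<beta>)"]])
    (auto simp: finite_centres finite_block)

lemma finite_configurations: "finite (configurations n V)"
proof (rule finite_subset)
  have "(\<Pi>\<^sub>E \<beta>\<in>centres n. {t. t \<subseteq> sides \<beta> \<and> disjoint t}) \<subseteq> (\<Pi>\<^sub>E \<beta>\<in>centres n. Pow (sides \<beta>))"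
    by (rule PiE_mono) auto
  then show "configurations n V \<subseteq> (\<Pi>\<^sub>E \<beta>\<in>centres n. Pow (sides \<beta>))"
    unfolding configurations_def by blast
qed (intro finite_PiE finite_centres, simp add: finite_sides)

text \<open>Once it is fixed which squares every block has to cover, the blocks can be filled independently, so the
  weights multiply.\<close>

lemma tiling_weight_by_covers:
  assumes "V \<subseteq> aztec_diamond (Suc n)"
  shows "(\<Sum>T\<in>domino_tilings V. \<Prod>\<beta>\<in>centres (Suc n). g \<beta> (T \<inter> sides \<beta>))
    = (\<Sum>X\<in>covers (Suc n) V. \<Prod>\<beta>\<in>centres (Suc n). cover_weight (g \<beta>) \<beta> (X \<beta>))"
proof -
  let ?C = "centres (Suc n)"
  let ?cover = "\<lambda>s. \<lambda>\<beta>\<in>?C. \<Union>(s \<beta>)"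
  have "(\<Sum>T\<in>domino_tilings V. \<Prod>\<beta>\<in>?C. g \<beta> (T \<inter> sides \<beta>))
    = (\<Sum>T\<in>domino_tilings V. \<Prod>\<beta>\<in>?C. g \<beta> ((\<lambda>\<beta>\<in>?C. T \<inter> sides \<beta>) \<beta>))"
    by (intro sum.cong prod.cong) auto
  also have "\<dots> = (\<Sum>s\<in>configurations (Suc n) V. \<Prod>\<beta>\<in>?C. g \<beta> (s \<beta>))"
    by (rule sum.reindex_bij_betw[OF tiling_configuration_bij[OF assms]])
  also have "\<dots> = (\<Sum>X\<in>covers (Suc n) V. \<Sum>s\<in>{s \<in> configurations (Suc n) V. ?cover s = X}. \<Prod>\<beta>\<in>?C. g \<beta> (s \<beta>))"
  proof (rule sum.group[symmetric, OF finite_configurations finite_covers])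
    show "?cover ` configurations (Suc n) V \<subseteq> covers (Suc n) V"
    proof
      fix X assume "X \<in> ?cover ` configurations (Suc n) V"
      then obtain s where s: "s \<in> configurations (Suc n) V" and X: "X = ?cover s" by blast
      have "{\<beta> \<in> ?C. c \<in> X \<beta>} = {\<beta> \<in> ?C. c \<in> \<Union>(s \<beta>)}" for c
        unfolding X by auto
      then have "card {\<beta> \<in> ?C. c \<in> X \<beta>} = of_bool (c \<in> V)" for c
        using s unfolding configurations_def by (simp only: mem_Collect_eq)
      moreover have "\<Union>(s \<beta>) \<subseteq> block \<beta>" if "\<beta> \<in> ?C" for \<beta>
      proof -
        have "s \<beta> \<subseteq> sides \<beta>" using s that unfolding configurations_def PiE_iff by blast
        then show ?thesis using side_subset_block by blast
      qed
      ultimately show "X \<in> covers (Suc n) V"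
        unfolding covers_def X by (auto simp: PiE_iff)
    qed
  qed
  also have "\<dots> = (\<Sum>X\<in>covers (Suc n) V. \<Prod>\<beta>\<in>?C. cover_weight (g \<beta>) \<beta> (X \<beta>))"
  proof (rule sum.cong[OF refl])
    fix X assume X: "X \<in> covers (Suc n) V"
    have "{s \<in> configurations (Suc n) V. ?cover s = X}
      = (\<Pi>\<^sub>E \<beta>\<in>?C. {t. t \<subseteq> sides \<beta> \<and> disjoint t \<and> \<Union>t = X \<beta>})" (is "?L = ?R")
    proof (intro equalityI subsetI)
      fix s assume "s \<in> ?L"
      then show "s \<in> ?R" by (auto simp: configurations_def PiE_iff)
    next
      fix s assume s: "s \<in> ?R"
      have "?cover s = X"
        using s X by (intro extensionalityI[of _ ?C]) (auto simp: covers_def PiE_iff)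
      moreover have "\<Union>(s \<beta>) = X \<beta>" if "\<beta> \<in> ?C" for \<beta>
        using s that unfolding PiE_iff by blast
      then have "{\<beta> \<in> ?C. c \<in> \<Union>(s \<beta>)} = {\<beta> \<in> ?C. c \<in> X \<beta>}" for c
        by (intro Collect_cong conj_cong) (simp_all only:)
      ultimately show "s \<in> ?L"
        using s X unfolding configurations_def covers_def PiE_iff by simp
    qed
    then show "(\<Sum>s\<in>{s \<in> configurations (Suc n) V. ?cover s = X}. \<Prod>\<beta>\<in>?C. g \<beta> (s \<beta>))
      = (\<Prod>\<beta>\<in>?C. cover_weight (g \<beta>) \<beta> (X \<beta>))"
      unfolding cover_weight_def
      by (subst prod_sum_PiE) (auto simp: finite_centres intro: finite_subset[OF _ finite_sides] finite_subset[OF _ finite_Pow_iff[THEN iffD2, OF finite_sides]])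
  qed
  finally show ?thesis .
qed

lemma subset_doubleton_iff: "t \<subseteq> {a, b} \<longleftrightarrow> t \<in> {{}, {a}, {b}, {a, b}}"
proof
  assume "t \<subseteq> {a, b}"
  then have "t \<in> Pow {a, b}" by (rule PowI)
  then show "t \<in> {{}, {a}, {b}, {a, b}}" unfolding Pow_insert Pow_empty by auto
qed auto

lemma subset_four_minus_two: "t \<subseteq> {a, b, c, d} \<Longrightarrow> c \<notin> t \<Longrightarrow> d \<notin> t \<Longrightarrow> t \<subseteq> {a, b}"
  by blast

text \<open>In the 4-cycle formed by the squares of a block a horizontal and a vertical side always meet.\<close>

lemma disjoint_sides_cases:
  "{t. t \<subseteq> sides \<beta> \<and> disjoint t} = {{}, {top_side \<beta>}, {bottom_side \<beta>}, {left_side \<beta>}, {right_side \<beta>},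
    {top_side \<beta>, bottom_side \<beta>}, {left_side \<beta>, right_side \<beta>}}" (is "?L = ?R")
proof -
  obtain l m where \<beta>: "\<beta> = (l, m)" by fastforce
  let ?N = "top_side \<beta>" and ?S = "bottom_side \<beta>" and ?W = "left_side \<beta>" and ?E = "right_side \<beta>"
  have meet: "?N \<inter> ?W \<noteq> {}" "?N \<inter> ?E \<noteq> {}" "?S \<inter> ?W \<noteq> {}" "?S \<inter> ?E \<noteq> {}"
    and apart: "?N \<inter> ?S = {}" "?W \<inter> ?E = {}"
    and neq: "?N \<noteq> ?W" "?N \<noteq> ?E" "?S \<noteq> ?W" "?S \<noteq> ?E"
    unfolding \<beta> by (auto simp: side_squares doubleton_eq_iff)
  show ?thesis
  proof (intro equalityI subsetI)
    fix t assume "t \<in> ?L"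
    then have sub: "t \<subseteq> {?N, ?S, ?W, ?E}" and "disjoint t" by (auto simp: sides_def)
    then have no: "\<not> (A \<in> t \<and> B \<in> t)" if "A \<inter> B \<noteq> {}" "A \<noteq> B" for A B
      using that disjointD by metis
    have "t \<subseteq> {?N, ?S} \<or> t \<subseteq> {?W, ?E}"
    proof (cases "?N \<in> t \<or> ?S \<in> t")
      case True
      then have "?W \<notin> t" "?E \<notin> t"
        using no[OF meet(1) neq(1)] no[OF meet(2) neq(2)] no[OF meet(3) neq(3)] no[OF meet(4) neq(4)]
        by (elim disjE; simp)+
      then show ?thesis using subset_four_minus_two[of t ?N ?S ?W ?E] sub by (intro disjI1)
    next
      case False
      moreover have "t \<subseteq> {?W, ?E, ?N, ?S}" using sub by (simp only: insert_commute)
      ultimately show ?thesis using subset_four_minus_two[of t ?W ?E ?N ?S] by (intro disjI2) simp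
    qed
    then have "t \<in> {{}, {?N}, {?S}, {?N, ?S}} \<or> t \<in> {{}, {?W}, {?E}, {?W, ?E}}"
      by (simp only: subset_doubleton_iff)
    then show "t \<in> ?R" by (elim disjE insertE emptyE; simp only: insert_iff simp_thms)
  next
    fix t assume "t \<in> ?R"
    then show "t \<in> ?L" using apart unfolding sides_def disjoint_def by auto
  qed
qed

lemma cover_weight_cases:
  "cover_weight g \<beta> Y = of_bool (Y = {}) * g {} + of_bool (Y = top_side \<beta>) * g {top_side \<beta>}
    + of_bool (Y = bottom_side \<beta>) * g {bottom_side \<beta>} + of_bool (Y = left_side \<beta>) * g {left_side \<beta>}
    + of_bool (Y = right_side \<beta>) * g {right_side \<beta>}
    + of_bool (Y = block \<beta>) * (g {top_side \<beta>, bottom_side \<beta>} + g {left_side \<beta>, right_side \<beta>})"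
proof -
  obtain l m where \<beta>: "\<beta> = (l, m)" by fastforce
  let ?N = "top_side \<beta>" and ?S = "bottom_side \<beta>" and ?W = "left_side \<beta>" and ?E = "right_side \<beta>"
  have neq: "?N \<noteq> ?S" "?W \<noteq> ?E" "?N \<noteq> ?W" "?N \<noteq> ?E" "?S \<noteq> ?W" "?S \<noteq> ?E"
    unfolding \<beta> by (auto simp: side_squares doubleton_eq_iff)
  have un: "?N \<union> ?S = block \<beta>" "?W \<union> ?E = block \<beta>"
    unfolding \<beta> by (auto simp: side_squares)
  define h where "h t = of_bool (\<Union>t = Y) * g t" for t
  have "cover_weight g \<beta> Y = (\<Sum>t\<in>{t \<in> {t. t \<subseteq> sides \<beta> \<and> disjoint t}. \<Union>t = Y}. g t)"
    by (simp add: cover_weight_def conj_assoc)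
  also have "\<dots> = (\<Sum>t\<in>{t. t \<subseteq> sides \<beta> \<and> disjoint t}. of_bool (\<Union>t = Y) * g t)"
  proof -
    have "finite {t. t \<subseteq> sides \<beta> \<and> disjoint t}" by (simp add: finite_sides)
    then show ?thesis by (simp only: sum.inter_filter) (rule sum.cong, simp_all)
  qed
  also have "\<dots> = h {} + h {?N} + h {?S} + h {?W} + h {?E} + h {?N, ?S} + h {?W, ?E}"
    unfolding disjoint_sides_cases h_def[symmetric] using neq neq[symmetric]
    by (simp add: doubleton_eq_iff add.assoc)
  also have "\<dots> = of_bool ({} = Y) * g {} + of_bool (?N = Y) * g {?N} + of_bool (?S = Y) * g {?S}
      + of_bool (?W = Y) * g {?W} + of_bool (?E = Y) * g {?E}
      + of_bool (block \<beta> = Y) * g {?N, ?S} + of_bool (block \<beta> = Y) * g {?W, ?E}"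
    unfolding h_def using un by simp
  finally show ?thesis by (simp add: eq_commute[of Y] distrib_left)
qed

text \<open>The local form of shuffling. A side is replaced by the opposite side, and the empty and the full block are
  exchanged, where a full block can be filled in two ways. Only the sum
  over the two ways counts, hence the form of the last two conditions. The power of 2 makes up for the number of ways: it is
  2 for an empty, 1 for a half covered and 1/2 for a full block.\<close>

lemma cover_weight_complement:
  assumes Y: "Y \<subseteq> block \<beta>"
    and single: "g {top_side \<beta>} = g' {bottom_side \<beta>}" "g {bottom_side \<beta>} = g' {top_side \<beta>}"
      "g {left_side \<beta>} = g' {right_side \<beta>}" "g {right_side \<beta>} = g' {left_side \<beta>}"
    and pair: "g {top_side \<beta>, bottom_side \<beta>} + g {left_side \<beta>, right_side \<beta>} = 2 * g' {}"
      "2 * g {} = g' {top_side \<beta>, bottom_side \<beta>} + g' {left_side \<beta>, right_side \<beta>}"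
  shows "cover_weight g \<beta> (block \<beta> - Y) = 2 powr (1 - card Y / 2) * cover_weight g' \<beta> Y"
proof -
  obtain l m where \<beta>: "\<beta> = (l, m)" by fastforce
  let ?N = "top_side \<beta>" and ?S = "bottom_side \<beta>" and ?W = "left_side \<beta>" and ?E = "right_side \<beta>"
  have un: "?N \<union> ?S = block \<beta>" "?W \<union> ?E = block \<beta>" "?N \<inter> ?S = {}" "?W \<inter> ?E = {}"
    unfolding \<beta> by (auto simp: side_squares)
  have cards: "card ?N = 2" "card ?S = 2" "card ?W = 2" "card ?E = 2" "card (block \<beta>) = 4"
    unfolding \<beta> by (simp_all add: side_squares)
  have flip: "block \<beta> - Y = {} \<longleftrightarrow> Y = block \<beta>" "block \<beta> - Y = block \<beta> \<longleftrightarrow> Y = {}"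
      "block \<beta> - Y = ?N \<longleftrightarrow> Y = ?S" "block \<beta> - Y = ?S \<longleftrightarrow> Y = ?N"
      "block \<beta> - Y = ?W \<longleftrightarrow> Y = ?E" "block \<beta> - Y = ?E \<longleftrightarrow> Y = ?W"
    using Y un by blast+
  define \<theta> :: real where "\<theta> = 2 powr (1 - card Y / 2)"
  have theta: "of_bool (Y = {}) * \<theta> = of_bool (Y = {}) * 2" "of_bool (Y = block \<beta>) * \<theta> = of_bool (Y = block \<beta>) / 2"
     "of_bool (Y = ?N) * \<theta> = of_bool (Y = ?N)" "of_bool (Y = ?S) * \<theta> = of_bool (Y = ?S)"
     "of_bool (Y = ?W) * \<theta> = of_bool (Y = ?W)" "of_bool (Y = ?E) * \<theta> = of_bool (Y = ?E)"
    unfolding \<theta>_def using cards by (auto simp: powr_minus)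
  have "\<theta> * cover_weight g' \<beta> Y = (of_bool (Y = {}) * \<theta>) * g' {} + (of_bool (Y = ?N) * \<theta>) * g' {?N}
    + (of_bool (Y = ?S) * \<theta>) * g' {?S} + (of_bool (Y = ?W) * \<theta>) * g' {?W}
    + (of_bool (Y = ?E) * \<theta>) * g' {?E} + (of_bool (Y = block \<beta>) * \<theta>) * (g' {?N, ?S} + g' {?W, ?E})"
    unfolding cover_weight_cases by (simp only: distrib_left mult_ac)
  also have "\<dots> = of_bool (Y = {}) * (2 * g' {}) + of_bool (Y = ?N) * g' {?N}
    + of_bool (Y = ?S) * g' {?S} + of_bool (Y = ?W) * g' {?W}
    + of_bool (Y = ?E) * g' {?E} + of_bool (Y = block \<beta>) * ((g' {?N, ?S} + g' {?W, ?E}) / 2)"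
    unfolding theta by (simp only: mult.assoc times_divide_eq_left times_divide_eq_right)
  also have "\<dots> = cover_weight g \<beta> (block \<beta> - Y)"
    unfolding cover_weight_cases flip pair(1)[symmetric] pair(2)[symmetric] single by simp
  finally show ?thesis unfolding \<theta>_def by simp
qed

lemma covers_complement:
  "bij_betw (\<lambda>X. \<lambda>\<beta>\<in>centres (Suc n). block \<beta> - X \<beta>)
    (covers (Suc n) (aztec_diamond n)) (covers (Suc n) (aztec_diamond (Suc n)))"
proof -
  let ?C = "centres (Suc n)"
  let ?c = "\<lambda>X. \<lambda>\<beta>\<in>?C. block \<beta> - X \<beta>"
  have count: "card {\<beta> \<in> ?C. c \<in> ?c X \<beta>} = card {\<beta> \<in> ?C. c \<in> block \<beta>} - card {\<beta> \<in> ?C. c \<in> X \<beta>}"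
    if X: "X \<in> (\<Pi>\<^sub>E \<beta>\<in>?C. Pow (block \<beta>))" for X c
  proof -
    have "{\<beta> \<in> ?C. c \<in> ?c X \<beta>} = {\<beta> \<in> ?C. c \<in> block \<beta>} - {\<beta> \<in> ?C. c \<in> X \<beta>}"
      by auto
    moreover have "{\<beta> \<in> ?C. c \<in> X \<beta>} \<subseteq> {\<beta> \<in> ?C. c \<in> block \<beta>}"
      using X unfolding PiE_iff by blast
    ultimately show ?thesis
      by (simp only: card_Diff_subset[OF finite_subset[OF _ finite_centres]] Collect_mono_iff)
         (subst card_Diff_subset; auto intro: finite_subset[OF _ finite_centres])
  qed
  have mem: "?c X \<in> covers (Suc n) W"
    if "X \<in> covers (Suc n) V" "{V, W} = {aztec_diamond n, aztec_diamond (Suc n)}" for X V W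
  proof -
    have X: "X \<in> (\<Pi>\<^sub>E \<beta>\<in>?C. Pow (block \<beta>))" "\<And>c. card {\<beta> \<in> ?C. c \<in> X \<beta>} = of_bool (c \<in> V)"
      using that(1) unfolding covers_def by blast+
    have "card {\<beta> \<in> ?C. c \<in> ?c X \<beta>} = of_bool (c \<in> W)" for c
      unfolding count[OF X(1)] blocks_at_square X(2)
      using that(2) aztec_diamond_mono[of n] by (auto simp: doubleton_eq_iff)
    moreover have "?c X \<in> (\<Pi>\<^sub>E \<beta>\<in>?C. Pow (block \<beta>))" by auto
    ultimately show ?thesis unfolding covers_def by blast
  qed
  have inv: "?c (?c X) = X" if "X \<in> covers (Suc n) V" for X V
  proof (rule extensionalityI[of _ ?C])
    have X: "X \<in> (\<Pi>\<^sub>E \<beta>\<in>?C. Pow (block \<beta>))" using that unfolding covers_def by blast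
    then show "X \<in> extensional ?C" unfolding PiE_def by blast
    show "?c (?c X) \<beta> = X \<beta>" if "\<beta> \<in> ?C" for \<beta>
      using X that unfolding PiE_iff by auto
  qed auto
  show ?thesis
    by (rule bij_betw_byWitness[where f' = ?c]) (use mem inv in blast)+
qed

text \<open>Since this sum is the same for all covers, the powers of 2 from the single blocks combine to a
  constant.\<close>

lemma cover_size:
  assumes "X \<in> covers n V" "finite V"
  shows "(\<Sum>\<beta>\<in>centres n. card (X \<beta>)) = card V"
proof -
  have count: "card {\<beta> \<in> centres n. c \<in> X \<beta>} = of_bool (c \<in> V)" for c
    using assms(1) unfolding covers_def by blast
  have sub: "X \<beta> \<subseteq> V" if "\<beta> \<in> centres n" for \<beta>
  proof
    fix c assume "c \<in> X \<beta>"
    then have "{\<beta> \<in> centres n. c \<in> X \<beta>} \<noteq> {}" using that by blast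
    moreover have "finite {\<beta> \<in> centres n. c \<in> X \<beta>}" using finite_centres by simp
    ultimately have "card {\<beta> \<in> centres n. c \<in> X \<beta>} \<noteq> 0" by (simp only: card_0_eq) simp
    then show "c \<in> V" unfolding count by simp
  qed
  have "(\<Sum>\<beta>\<in>centres n. card (X \<beta>)) = (\<Sum>\<beta>\<in>centres n. \<Sum>c\<in>V. of_bool (c \<in> X \<beta>))"
    using sub assms(2) by (intro sum.cong refl) (simp add: Int_absorb1)
  also have "\<dots> = (\<Sum>c\<in>V. \<Sum>\<beta>\<in>centres n. of_bool (c \<in> X \<beta>))" by (rule sum.swap)
  also have "\<dots> = (\<Sum>c\<in>V. card {\<beta> \<in> centres n. c \<in> X \<beta>})"
    by (simp add: finite_centres Int_def)
  also have "\<dots> = card V" unfolding count by simp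
  finally show ?thesis .
qed

text \<open>The conditions hold in particular when \<open>g'\<close> is, in every block, the mean of \<open>g\<close> over the outcomes of
  shuffling.\<close>

lemma shuffling:
  fixes g g' :: "int \<times> int \<Rightarrow> (int \<times> int) set set \<Rightarrow> real"
  assumes "\<And>\<beta>. \<beta> \<in> centres (Suc n) \<Longrightarrow> g \<beta> {top_side \<beta>} = g' \<beta> {bottom_side \<beta>}"
    "\<And>\<beta>. \<beta> \<in> centres (Suc n) \<Longrightarrow> g \<beta> {bottom_side \<beta>} = g' \<beta> {top_side \<beta>}"
    "\<And>\<beta>. \<beta> \<in> centres (Suc n) \<Longrightarrow> g \<beta> {left_side \<beta>} = g' \<beta> {right_side \<beta>}"
    "\<And>\<beta>. \<beta> \<in> centres (Suc n) \<Longrightarrow> g \<beta> {right_side \<beta>} = g' \<beta> {left_side \<beta>}"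
    "\<And>\<beta>. \<beta> \<in> centres (Suc n) \<Longrightarrow>
      g \<beta> {top_side \<beta>, bottom_side \<beta>} + g \<beta> {left_side \<beta>, right_side \<beta>} = 2 * g' \<beta> {}"
    "\<And>\<beta>. \<beta> \<in> centres (Suc n) \<Longrightarrow>
      2 * g \<beta> {} = g' \<beta> {top_side \<beta>, bottom_side \<beta>} + g' \<beta> {left_side \<beta>, right_side \<beta>}"
  shows "(\<Sum>T\<in>domino_tilings (aztec_diamond (Suc n)). \<Prod>\<beta>\<in>centres (Suc n). g \<beta> (T \<inter> sides \<beta>))
    = 2 powr (card (centres (Suc n)) - card (aztec_diamond n) / 2)
      * (\<Sum>T\<in>domino_tilings (aztec_diamond n). \<Prod>\<beta>\<in>centres (Suc n). g' \<beta> (T \<inter> sides \<beta>))"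
proof -
  let ?C = "centres (Suc n)"
  let ?K = "2 powr (card ?C - card (aztec_diamond n) / 2) :: real"
  have "(\<Sum>T\<in>domino_tilings (aztec_diamond (Suc n)). \<Prod>\<beta>\<in>?C. g \<beta> (T \<inter> sides \<beta>))
    = (\<Sum>X\<in>covers (Suc n) (aztec_diamond (Suc n)). \<Prod>\<beta>\<in>?C. cover_weight (g \<beta>) \<beta> (X \<beta>))"
    by (rule tiling_weight_by_covers) simp
  also have "\<dots> = (\<Sum>X\<in>covers (Suc n) (aztec_diamond n).
      \<Prod>\<beta>\<in>?C. cover_weight (g \<beta>) \<beta> ((\<lambda>\<beta>\<in>?C. block \<beta> - X \<beta>) \<beta>))"
    by (rule sum.reindex_bij_betw[OF covers_complement, symmetric])
  also have "\<dots> = (\<Sum>X\<in>covers (Suc n) (aztec_diamond n).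
      ?K * (\<Prod>\<beta>\<in>?C. cover_weight (g' \<beta>) \<beta> (X \<beta>)))"
  proof (rule sum.cong[OF refl])
    fix X assume X: "X \<in> covers (Suc n) (aztec_diamond n)"
    have "(\<Prod>\<beta>\<in>?C. cover_weight (g \<beta>) \<beta> ((\<lambda>\<beta>\<in>?C. block \<beta> - X \<beta>) \<beta>))
        = (\<Prod>\<beta>\<in>?C. 2 powr (1 - card (X \<beta>) / 2) * cover_weight (g' \<beta>) \<beta> (X \<beta>))"
    proof (rule prod.cong[OF refl])
      fix \<beta> assume \<beta>: "\<beta> \<in> ?C"
      have "X \<beta> \<subseteq> block \<beta>" using X \<beta> unfolding covers_def PiE_iff by blast
      then have "cover_weight (g \<beta>) \<beta> (block \<beta> - X \<beta>)
          = 2 powr (1 - card (X \<beta>) / 2) * cover_weight (g' \<beta>) \<beta> (X \<beta>)"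
        using assms[OF \<beta>] by (rule cover_weight_complement)
      then show "cover_weight (g \<beta>) \<beta> ((\<lambda>\<beta>\<in>?C. block \<beta> - X \<beta>) \<beta>)
          = 2 powr (1 - card (X \<beta>) / 2) * cover_weight (g' \<beta>) \<beta> (X \<beta>)"
        using \<beta> by simp
    qed
    also have "\<dots> = (\<Prod>\<beta>\<in>?C. 2 powr (1 - card (X \<beta>) / 2)) * (\<Prod>\<beta>\<in>?C. cover_weight (g' \<beta>) \<beta> (X \<beta>))"
      by (rule prod.distrib)
    also have "(\<Prod>\<beta>\<in>?C. 2 powr (1 - card (X \<beta>) / 2) :: real) = 2 powr (\<Sum>\<beta>\<in>?C. 1 - card (X \<beta>) / 2)"
      by (rule powr_sum[symmetric]) (auto simp: finite_centres)
    also have "(\<Sum>\<beta>\<in>?C. 1 - real (card (X \<beta>)) / 2) = card ?C - card (aztec_diamond n) / 2"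
      using cover_size[OF X finite_aztec_diamond]
      by (simp add: sum_subtractf flip: sum_divide_distrib of_nat_sum)
    finally show "(\<Prod>\<beta>\<in>?C. cover_weight (g \<beta>) \<beta> ((\<lambda>\<beta>\<in>?C. block \<beta> - X \<beta>) \<beta>))
        = ?K * (\<Prod>\<beta>\<in>?C. cover_weight (g' \<beta>) \<beta> (X \<beta>))" .
  qed
  also have "\<dots> = ?K * (\<Sum>T\<in>domino_tilings (aztec_diamond n). \<Prod>\<beta>\<in>?C. g' \<beta> (T \<inter> sides \<beta>))"
    by (simp only: tiling_weight_by_covers[OF aztec_diamond_mono] sum_distrib_left)
  finally show ?thesis .
qed

lemma finite_domino_tilings: "finite V \<Longrightarrow> finite (domino_tilings V)"
  by (rule finite_subset[of _ "Pow (Pow V)"]) (auto simp: domino_tilings_def partition_on_def)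

lemma shuffling_count:
  "real (card (domino_tilings (aztec_diamond (Suc n))))
    = 2 powr (card (centres (Suc n)) - card (aztec_diamond n) / 2) * card (domino_tilings (aztec_diamond n))"
  using shuffling[of n "\<lambda>_ _. 1" "\<lambda>_ _. 1"] by simp

lemma domino_tilings_empty: "domino_tilings {} = {{}}"
  by (auto simp: domino_tilings_def partition_on_def)

lemma aztec_diamond_0: "aztec_diamond 0 = {}"
proof -
  have "(i, j) \<notin> aztec_diamond 0" for i j :: int
    unfolding aztec_diamond_iff by presburger
  then show ?thesis by auto
qed

lemma tilings_card_pos: "card (domino_tilings (aztec_diamond n)) > 0"
proof (induction n)
  case (Suc n)
  then have "real (card (domino_tilings (aztec_diamond (Suc n)))) > 0"
    unfolding shuffling_count by simp
  then show ?case by simp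
qed (simp add: aztec_diamond_0 domino_tilings_empty)

definition domino_prob :: "nat \<Rightarrow> (int \<times> int) set \<Rightarrow> real" where
  "domino_prob n d = (\<Sum>T\<in>domino_tilings (aztec_diamond n). of_bool (d \<in> T))
     / card (domino_tilings (aztec_diamond n))"

lemma domino_prob_outside: "\<not> d \<subseteq> aztec_diamond n \<Longrightarrow> domino_prob n d = 0"
proof -
  assume "\<not> d \<subseteq> aztec_diamond n"
  then have "d \<notin> T" if "T \<in> domino_tilings (aztec_diamond n)" for T
    using that unfolding domino_tilings_def partition_on_def by blast
  then show ?thesis by (simp add: domino_prob_def)
qed

text \<open>Take for \<open>g\<close> the indicator of \<open>d\<close> in the block \<open>\<beta>\<close>. A weight \<open>g'\<close> that fits is the indicator of the
  opposite side \<open>e\<close> plus half of one minus the number of sides in use: for an empty block it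
  is \<open>1 / 2\<close>, the chance that the new pair of sides contains \<open>d\<close>, and on the two fillings of a full block,
  which shuffling destroys, it adds up to zero.\<close>

lemma domino_prob_shuffle:
  assumes \<beta>: "\<beta> \<in> centres (Suc n)"
    and de: "(d, e) \<in> {(top_side \<beta>, bottom_side \<beta>), (bottom_side \<beta>, top_side \<beta>),
      (left_side \<beta>, right_side \<beta>), (right_side \<beta>, left_side \<beta>)}"
  shows "domino_prob (Suc n) d = domino_prob n e
    + (1 - (domino_prob n (top_side \<beta>) + domino_prob n (bottom_side \<beta>)
        + domino_prob n (left_side \<beta>) + domino_prob n (right_side \<beta>))) / 2"
proof -
  let ?C = "centres (Suc n)"
  let ?T = "domino_tilings (aztec_diamond n)"
  let ?K = "2 powr (card ?C - card (aztec_diamond n) / 2) :: real"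
  obtain l m where lm: "\<beta> = (l, m)" by fastforce
  have neq: "top_side \<beta> \<noteq> bottom_side \<beta>" "left_side \<beta> \<noteq> right_side \<beta>" "top_side \<beta> \<noteq> left_side \<beta>"
    "top_side \<beta> \<noteq> right_side \<beta>" "bottom_side \<beta> \<noteq> left_side \<beta>" "bottom_side \<beta> \<noteq> right_side \<beta>"
    unfolding lm by (simp_all add: domino_eq_iff)
  define f :: "(int \<times> int) set set \<Rightarrow> real" where "f t = of_bool (d \<in> t)" for t
  define f' :: "(int \<times> int) set set \<Rightarrow> real" where "f' t = of_bool (e \<in> t) + (1 - real (card t)) / 2" for t
  have sides: "d \<in> sides \<beta>" "e \<in> sides \<beta>" using de by (auto simp: sides_def)
  have only: "(\<Prod>\<gamma>\<in>?C. if \<gamma> = \<beta> then h (T \<inter> sides \<gamma>) else 1) = h (T \<inter> sides \<beta>)"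
    for h :: "(int \<times> int) set set \<Rightarrow> real" and T
    using \<beta> by (simp add: finite_centres)
  have f_side: "f (T \<inter> sides \<beta>) = of_bool (d \<in> T)" for T
    using sides by (simp add: f_def)
  have f'_side: "f' (T \<inter> sides \<beta>) = of_bool (e \<in> T) + (1 - (of_bool (top_side \<beta> \<in> T)
      + of_bool (bottom_side \<beta> \<in> T) + of_bool (left_side \<beta> \<in> T) + of_bool (right_side \<beta> \<in> T))) / 2" for T
  proof -
    have "real (card (T \<inter> sides \<beta>)) = (\<Sum>x\<in>sides \<beta>. of_bool (x \<in> T))"
      by (simp add: finite_sides Int_commute)
    also have "\<dots> = of_bool (top_side \<beta> \<in> T) + of_bool (bottom_side \<beta> \<in> T)
        + of_bool (left_side \<beta> \<in> T) + of_bool (right_side \<beta> \<in> T)"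
      unfolding sides_def using neq by (simp del: sum_of_bool_eq add: add.assoc)
    finally show ?thesis using sides by (simp add: f'_def)
  qed
  have transition: "f {top_side \<beta>} = f' {bottom_side \<beta>}" "f {bottom_side \<beta>} = f' {top_side \<beta>}"
    "f {left_side \<beta>} = f' {right_side \<beta>}" "f {right_side \<beta>} = f' {left_side \<beta>}"
    "f {top_side \<beta>, bottom_side \<beta>} + f {left_side \<beta>, right_side \<beta>} = 2 * f' {}"
    "2 * f {} = f' {top_side \<beta>, bottom_side \<beta>} + f' {left_side \<beta>, right_side \<beta>}"
    using de by (elim insertE emptyE; simp add: f_def f'_def neq neq[symmetric])+
  have "(\<Sum>T\<in>domino_tilings (aztec_diamond (Suc n)). \<Prod>\<gamma>\<in>?C. if \<gamma> = \<beta> then f (T \<inter> sides \<gamma>) else 1)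
    = ?K * (\<Sum>T\<in>?T. \<Prod>\<gamma>\<in>?C. if \<gamma> = \<beta> then f' (T \<inter> sides \<gamma>) else 1)"
    by (rule shuffling[where g = "\<lambda>\<gamma> t. if \<gamma> = \<beta> then f t else 1" and g' = "\<lambda>\<gamma> t. if \<gamma> = \<beta> then f' t else 1"])
      (use transition in \<open>simp_all split: if_split\<close>)
  then have "(\<Sum>T\<in>domino_tilings (aztec_diamond (Suc n)). of_bool (d \<in> T))
    = ?K * (\<Sum>T\<in>?T. of_bool (e \<in> T) + (1 - (of_bool (top_side \<beta> \<in> T)
      + of_bool (bottom_side \<beta> \<in> T) + of_bool (left_side \<beta> \<in> T) + of_bool (right_side \<beta> \<in> T))) / 2)"
    unfolding only f_side f'_side .
  also have "(\<Sum>T\<in>?T. of_bool (e \<in> T) + (1 - (of_bool (top_side \<beta> \<in> T)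
      + of_bool (bottom_side \<beta> \<in> T) + of_bool (left_side \<beta> \<in> T) + of_bool (right_side \<beta> \<in> T))) / 2)
    = card ?T * (domino_prob n e + (1 - (domino_prob n (top_side \<beta>) + domino_prob n (bottom_side \<beta>)
        + domino_prob n (left_side \<beta>) + domino_prob n (right_side \<beta>))) / 2)"
    using tilings_card_pos[of n]
    by (simp add: domino_prob_def sum.distrib sum_subtractf field_simps flip: sum_divide_distrib del: sum_of_bool_eq)
      (simp add: sum_distrib_left del: sum_of_bool_eq)
  finally show ?thesis
    unfolding domino_prob_def[of "Suc n"] shuffling_count
    using tilings_card_pos[of n] by simp
qed

section \<open>Creation rates and their accumulation\<close>

text \<open>By \<open>creation_balance\<close> and \<open>domino_prob_flow\<close> below, \<open>creation n l m\<close> is the net creation rate in the block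
  around \<open>(l, m)\<close> when a random tiling of size \<open>n\<close> is shuffled: the probability that the block
  is empty minus the probability that it is full. Its recursion says that the generating function is the
  inverse of \<open>1 - (x + 1/x + y + 1/y) z / 2 + z\<^sup>2\<close>. With integers as times and the value 0 in the past it
  holds at all times, and no initial cases are needed below.\<close>

function creation :: "int \<Rightarrow> int \<Rightarrow> int \<Rightarrow> real" where
  "creation t l m = (if t < 0 then 0 else
     of_bool (t = 0 \<and> l = 0 \<and> m = 0) - creation (t - 2) l m
     + (creation (t - 1) (l - 1) m + creation (t - 1) (l + 1) m
        + creation (t - 1) l (m - 1) + creation (t - 1) l (m + 1)) / 2)"
  by auto
termination by (relation "Wellfounded.measure (\<lambda>(t, l, m). nat (t + 2))") auto

declare creation.simps [simp del]

lemma time_induct [case_names past step]: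
  assumes "\<And>t. t < 0 \<Longrightarrow> P t"
    and "\<And>t. 0 \<le> t \<Longrightarrow> P (t - 1) \<Longrightarrow> P (t - 2) \<Longrightarrow> P t"
  shows "P (t :: int)"
proof (induction "nat (t + 2)" arbitrary: t rule: less_induct)
  case less
  show ?case
  proof (cases "t < 0")
    case False
    then show ?thesis by (auto intro!: assms(2)[of t] less[of "t - 1"] less[of "t - 2"])
  qed (use assms(1) in blast)
qed

lemma creation_past: "t < 0 \<Longrightarrow> creation t l m = 0"
  by (simp add: creation.simps)

lemma creation_rec:
  "creation t l m = of_bool (t = 0 \<and> l = 0 \<and> m = 0) - creation (t - 2) l m
     + (creation (t - 1) (l - 1) m + creation (t - 1) (l + 1) m
        + creation (t - 1) l (m - 1) + creation (t - 1) l (m + 1)) / 2"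
proof (cases "t < 0")
  case False
  then show ?thesis by (subst creation.simps) simp
qed (simp add: creation_past)

lemma creation_minus_right: "creation t l (- m) = creation t l m"
proof (induction t arbitrary: l m rule: time_induct)
  case (step t)
  have shifts: "- m - 1 = - (m + 1)" "- m + 1 = - (m - 1)" by simp_all
  have "creation (t - 1) l (- m - 1) = creation (t - 1) l (m + 1)"
    "creation (t - 1) l (- m + 1) = creation (t - 1) l (m - 1)"
    by (simp_all only: shifts step(2))
  then show ?case
    by (subst (1 2) creation_rec) (simp add: step)
qed (simp add: creation_past)

lemma creation_reflect_shift: "creation t l (- m - 1) = creation t l (m + 1)"
  using creation_minus_right[of t l "m + 1"] by simp

lemma creation_swap: "creation t l m = creation t m l"
proof (induction t arbitrary: l m rule: time_induct)
  case (step t)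
  show ?case
    by (subst (1 2) creation_rec) (simp add: step(2)[of l] step(2)[of "l-1"] step(2)[of "l+1"] step(3)[of l] conj_commute)
qed (simp add: creation_past)

lemma creation_minus_left: "creation t (- l) m = creation t l m"
  by (metis creation_swap creation_minus_right)

lemma creation_abs: "creation t \<bar>l\<bar> \<bar>m\<bar> = creation t l m"
  by (auto simp: abs_if creation_minus_left creation_minus_right)

lemma creation_outside: "\<bar>l\<bar> + \<bar>m\<bar> > t \<Longrightarrow> creation t l m = 0"
proof (induction t arbitrary: l m rule: time_induct)
  case (step t)
  have "creation (t - 1) (l - 1) m = 0" "creation (t - 1) (l + 1) m = 0"
    "creation (t - 1) l (m - 1) = 0" "creation (t - 1) l (m + 1) = 0" "creation (t - 2) l m = 0"
    using step(4) by (auto intro!: step)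
  then show ?case
    using step(1,4) by (subst creation_rec) auto
qed (simp add: creation_past)

lemma creation_odd: "odd (t + l + m) \<Longrightarrow> creation t l m = 0"
proof (induction t arbitrary: l m rule: time_induct)
  case (step t)
  have "creation (t - 1) (l - 1) m = 0" "creation (t - 1) (l + 1) m = 0"
    "creation (t - 1) l (m - 1) = 0" "creation (t - 1) l (m + 1) = 0" "creation (t - 2) l m = 0"
    using step(4) by (auto intro!: step)
  then show ?case
    using step(1,4) by (subst creation_rec) auto
qed (simp add: creation_past)

text \<open>The sum of the creation rates along a line of slope one in space-time. A domino that enters the tiling
  as upper side of a block travels upwards along such a line.\<close>

function flow :: "int \<Rightarrow> int \<Rightarrow> int \<Rightarrow> real" where
  "flow t l m = (if t < 0 then 0 else flow (t - 1) l (m - 1) + creation t l m)"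
  by auto
termination by (relation "Wellfounded.measure (\<lambda>(t, l, m). nat (t + 1))") auto

declare flow.simps [simp del]

lemma flow_past: "t < 0 \<Longrightarrow> flow t l m = 0"
  by (simp add: flow.simps)

lemma flow_rec: "flow t l m = flow (t - 1) l (m - 1) + creation t l m"
  by (cases "t < 0") (simp_all add: flow_past creation_past flow.simps[of t])

lemma flow_minus_left: "flow t (- l) m = flow t l m"
proof (induction t arbitrary: m rule: time_induct)
  case (step t)
  show ?case by (subst (1 2) flow_rec) (simp add: step creation_minus_left)
qed (simp add: flow_past)

lemma flow_abs_left: "flow t \<bar>l\<bar> m = flow t l m"
  by (simp add: abs_if flow_minus_left)

lemma flow_outside: "\<bar>l\<bar> + \<bar>m\<bar> > t \<Longrightarrow> flow t l m = 0"
proof (induction t arbitrary: m rule: time_induct)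
  case (step t)
  have "flow (t - 1) l (m - 1) = 0" using step(4) by (intro step) auto
  then show ?case
    by (subst flow_rec) (simp add: creation_outside[OF step(4)])
qed (simp add: flow_past)

text \<open>In terms of generating functions: with \<open>A = (1 - x z) (1 - z / x)\<close>, \<open>B = (1 - y z) (1 - z / y)\<close> and
  \<open>(A + B) C = 2\<close> the flow is \<open>C / (1 - y z)\<close>, and \<open>A C / (1 - y z) = 2 / (1 - y z) - (1 - z / y) C\<close>.\<close>

lemma flow_wave:
  "flow t l m + flow (t - 2) l m - flow (t - 1) (l - 1) m - flow (t - 1) (l + 1) m
    = 2 * of_bool (t \<ge> 0 \<and> l = 0 \<and> m = t) - creation t l m + creation (t - 1) l (m + 1)"
proof (induction t arbitrary: m rule: time_induct)
  case (step t)
  have "flow t l m + flow (t - 2) l m - flow (t - 1) (l - 1) m - flow (t - 1) (l + 1) m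
    = (flow (t - 1) l (m - 1) + flow (t - 1 - 2) l (m - 1) - flow (t - 1 - 1) (l - 1) (m - 1)
        - flow (t - 1 - 1) (l + 1) (m - 1))
      + creation t l m + creation (t - 2) l m - creation (t - 1) (l - 1) m - creation (t - 1) (l + 1) m"
    using flow_rec[of t l m] flow_rec[of "t-2" l m] flow_rec[of "t-1" "l-1" m] flow_rec[of "t-1" "l+1" m]
    by simp
  also have "\<dots> = 2 * of_bool (t \<ge> 0 \<and> l = 0 \<and> m = t) - creation t l m + creation (t - 1) l (m + 1)"
    unfolding step(2) using creation_rec[of t l m] step(1) by (auto simp: field_simps of_bool_def)
  finally show ?case .
qed (simp add: flow_past creation_past)

text \<open>Twice the probability of \<open>horizontal_domino l m\<close>, summed over the sizes \<open>t\<close> and \<open>t + 1\<close>: at one of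
  them it is an upper side, at the other a lower side of its block. The generating function is \<open>(1 - z\<^sup>2) C / B\<close>.\<close>

definition two_way_flow :: "int \<Rightarrow> int \<Rightarrow> int \<Rightarrow> real" where
  "two_way_flow t l m = flow t l m + flow (t - 1) l (- m - 1)"

lemma two_way_flow_past: "t < 0 \<Longrightarrow> two_way_flow t l m = 0"
  by (simp add: two_way_flow_def flow_past)

lemma two_way_flow_wave_left:
  "two_way_flow t l m + two_way_flow (t - 2) l m - two_way_flow (t - 1) (l - 1) m
      - two_way_flow (t - 1) (l + 1) m
    = 2 * of_bool (t \<ge> 0 \<and> l = 0 \<and> \<bar>m\<bar> = t) - creation t l m + creation (t - 2) l m"
proof -
  have "of_bool (t \<ge> 0 \<and> l = 0 \<and> m = t) + of_bool (t - 1 \<ge> 0 \<and> l = 0 \<and> - m - 1 = t - 1)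
      = (of_bool (t \<ge> 0 \<and> l = 0 \<and> \<bar>m\<bar> = t) :: real)"
    by auto
  then show ?thesis
    using flow_wave[of t l m] flow_wave[of "t - 1" l "- m - 1"]
      creation_minus_right[of "t - 2" l m] creation_reflect_shift[of "t - 1" l m]
    by (simp add: two_way_flow_def)
qed

lemma two_way_flow_wave_right:
  "two_way_flow t m l + two_way_flow (t - 2) m l - two_way_flow (t - 1) m (l - 1)
      - two_way_flow (t - 1) m (l + 1)
    = creation t l m - creation (t - 2) l m"
  using flow_rec[of t m l] flow_rec[of "t - 1" m "l + 1"]
    flow_rec[of "t - 1" m "- l - 1"] flow_rec[of "t - 2" m "- l"]
    creation_minus_right[of "t - 2" m l] creation_reflect_shift[of "t - 1" m l]
    creation_swap[of t l m] creation_swap[of "t-2" l m]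
  by (simp add: two_way_flow_def)

text \<open>In terms of shuffling: the expected numbers of sides of a block before and after shuffling
  add up to 2. For the flows this follows from the recursion of the creation rates. By the two preceding lemmas the operator \<open>A\<close> takes the left-hand side to
  \<open>2 (1 - z\<^sup>2) / B\<close>, the sum over the two rays \<open>l = 0\<close>, \<open>m = \<plusminus>t\<close>. The right-hand side has the same image,
  and \<open>A\<close> determines a function that vanishes in the past.\<close>

lemma two_way_flow_total:
  "two_way_flow t l m + two_way_flow t m l = 2 * of_bool (\<bar>l\<bar> + \<bar>m\<bar> \<le> t \<and> even (t + l + m))"
proof (induction t arbitrary: l rule: time_induct)
  case (step t)
  define I :: "int \<Rightarrow> int \<Rightarrow> real" where
    "I t l = of_bool (\<bar>l\<bar> + \<bar>m\<bar> \<le> t \<and> even (t + l + m))" for t l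
  have wave: "I t l + I (t - 2) l - I (t - 1) (l - 1) - I (t - 1) (l + 1) = of_bool (l = 0 \<and> \<bar>m\<bar> = t)"
  proof (cases "even (t + l + m)")
    case True
    consider "l = 0" | "l > 0" | "l < 0" by linarith
    then show ?thesis
    proof cases
      case 1
      then show ?thesis using True step(1) by (auto simp: I_def of_bool_def; arith)
    next
      case 2
      then show ?thesis using True step(1) by (auto simp: I_def of_bool_def; arith)
    next
      case 3
      then show ?thesis using True step(1) by (auto simp: I_def of_bool_def; arith)
    qed
  next
    case False
    then show ?thesis using step(1) by (auto simp: I_def of_bool_def; presburger)
  qed
  show ?case
    using two_way_flow_wave_left[of t l m] two_way_flow_wave_right[of t m l] wave
      step(2)[of "l - 1"] step(2)[of "l + 1"] step(3)[of l] step(1)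
    unfolding I_def[symmetric] by simp
qed (auto simp: two_way_flow_past)

text \<open>The creation rate is one minus half of the four flows that enter the block. When the flows are
  twice the placement probabilities at one time, this makes them so at the next.\<close>

lemma creation_balance:
  "creation t l m = of_bool (\<bar>l\<bar> + \<bar>m\<bar> \<le> t \<and> even (t + l + m))
     - (flow (t - 1) l (m - 1) + flow (t - 1) l (- m - 1)
        + flow (t - 1) m (l - 1) + flow (t - 1) m (- l - 1)) / 2"
proof -
  define I :: real where "I = of_bool (\<bar>l\<bar> + \<bar>m\<bar> \<le> t \<and> even (t + l + m))"
  have "two_way_flow t l m + two_way_flow t m l = 2 * I"
    unfolding I_def by (rule two_way_flow_total)
  then show ?thesis
    unfolding I_def[symmetric] two_way_flow_def
    using flow_rec[of t l m] flow_rec[of t m l] creation_swap[of t l m] by (simp add: field_simps)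
qed

section \<open>Placement probabilities\<close>

text \<open>Each direction travels along its own line, and by \<open>creation_balance\<close> the creation rate of a block is one minus the
  sum of the probabilities of its sides, as \<open>domino_prob_shuffle\<close> requires. At points that are not centres
  both sides vanish.\<close>

lemma domino_prob_flow:
  assumes "odd (l + m + int n)"
  shows "domino_prob n (top_side (l, m)) = flow (int n - 1) l m / 2"
    "domino_prob n (bottom_side (l, m)) = flow (int n - 1) l (- m) / 2"
    "domino_prob n (right_side (l, m)) = flow (int n - 1) m l / 2"
    "domino_prob n (left_side (l, m)) = flow (int n - 1) m (- l) / 2"
  using assms
proof (induction n arbitrary: l m)
  case 0
  {
    case 1 then show ?case
      by (subst domino_prob_outside) (simp_all add: aztec_diamond_0 flow_past side_squares)
  next
    case 2 then show ?case
      by (subst domino_prob_outside) (simp_all add: aztec_diamond_0 flow_past side_squares)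
  next
    case 3 then show ?case
      by (subst domino_prob_outside) (simp_all add: aztec_diamond_0 flow_past side_squares)
  next
    case 4 then show ?case
      by (subst domino_prob_outside) (simp_all add: aztec_diamond_0 flow_past side_squares)
  }
next
  case (Suc n)
  have step: "domino_prob (Suc n) (top_side (l, m)) = flow (int (Suc n) - 1) l m / 2 \<and>
    domino_prob (Suc n) (bottom_side (l, m)) = flow (int (Suc n) - 1) l (- m) / 2 \<and>
    domino_prob (Suc n) (right_side (l, m)) = flow (int (Suc n) - 1) m l / 2 \<and>
    domino_prob (Suc n) (left_side (l, m)) = flow (int (Suc n) - 1) m (- l) / 2"
    if parity: "odd (l + m + int (Suc n))" for l m
  proof (cases "(l, m) \<in> centres (Suc n)")
    case False
    then have far: "\<bar>l\<bar> + \<bar>m\<bar> > int n" using parity by (auto simp: centres_def)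
    have "domino_prob (Suc n) d = 0" if d: "d \<in> sides (l, m)" for d
    proof (rule domino_prob_outside, rule notI)
      assume "d \<subseteq> aztec_diamond (Suc n)"
      moreover have "d \<in> dominoes" using d sides_dominoes by blast
      ultimately obtain \<gamma> where \<gamma>: "\<gamma> \<in> centres (Suc n)" "d \<in> sides \<gamma>"
        using domino_is_side by blast
      obtain l' m' where lm: "\<gamma> = (l', m')" by fastforce
      have "even (l + m + (l' + m'))"
        using parity \<gamma>(1) unfolding lm by (auto simp: centres_def)
      then have "(l, m) = \<gamma>" using side_unique[OF d] \<gamma>(2) unfolding lm by blast
      then show False using False \<gamma>(1) by simp
    qed
    then show ?thesis using far by (simp add: sides_def flow_outside)
  next
    case True
    have old: "domino_prob n (bottom_side (l, m)) = flow (int n - 1) l (m - 1) / 2"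
      "domino_prob n (top_side (l, m)) = flow (int n - 1) l (- m - 1) / 2"
      "domino_prob n (left_side (l, m)) = flow (int n - 1) m (l - 1) / 2"
      "domino_prob n (right_side (l, m)) = flow (int n - 1) m (- l - 1) / 2"
    proof -
      have near: "odd (l + (m - 1) + int n)" "odd (l + (m + 1) + int n)"
        "odd ((l - 1) + m + int n)" "odd ((l + 1) + m + int n)"
        using parity by auto
      show "domino_prob n (bottom_side (l, m)) = flow (int n - 1) l (m - 1) / 2"
        "domino_prob n (top_side (l, m)) = flow (int n - 1) l (- m - 1) / 2"
        "domino_prob n (left_side (l, m)) = flow (int n - 1) m (l - 1) / 2"
        "domino_prob n (right_side (l, m)) = flow (int n - 1) m (- l - 1) / 2"
        using Suc.IH(1)[OF near(1)] Suc.IH(2)[OF near(2)] Suc.IH(3)[OF near(3)] Suc.IH(4)[OF near(4)]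
        by simp_all
    qed
    have balance: "creation (int n) l m = 1 - (flow (int n - 1) l (m - 1) + flow (int n - 1) l (- m - 1)
        + flow (int n - 1) m (l - 1) + flow (int n - 1) m (- l - 1)) / 2"
    proof -
      have "\<bar>l\<bar> + \<bar>m\<bar> \<le> int n" "even (int n + l + m)"
        using True parity by (auto simp: centres_def)
      then show ?thesis by (subst creation_balance) (simp only: simp_thms of_bool_eq)
    qed
    have new: "domino_prob (Suc n) d = domino_prob n e + creation (int n) l m / 2"
      if "(d, e) \<in> {(top_side (l, m), bottom_side (l, m)), (bottom_side (l, m), top_side (l, m)),
      (left_side (l, m), right_side (l, m)), (right_side (l, m), left_side (l, m))}" for d e
      unfolding domino_prob_shuffle[OF True that] old balance by (simp add: field_simps)
    show ?thesis
      using new[of "top_side (l, m)" "bottom_side (l, m)"] new[of "bottom_side (l, m)" "top_side (l, m)"]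
        new[of "left_side (l, m)" "right_side (l, m)"] new[of "right_side (l, m)" "left_side (l, m)"]
        flow_rec[of "int n" l m] flow_rec[of "int n" l "- m"] flow_rec[of "int n" m l] flow_rec[of "int n" m "- l"]
        creation_minus_right[of "int n" l m] creation_minus_right[of "int n" m l] creation_swap[of "int n" l m]
      unfolding old by simp
  qed
  {
    case 1 then show ?case using step by blast
  next
    case 2 then show ?case using step by blast
  next
    case 3 then show ?case using step by blast
  next
    case 4 then show ?case using step by blast
  }
qed

lemma placement_prob_flow:
  assumes "odd (l + m + int n)"
  shows "placement_prob l m n = flow (int n - 1) l m / 2"
proof -
  let ?T = "domino_tilings (aztec_diamond n)"
  have fin: "finite ?T" by (intro finite_domino_tilings finite_aztec_diamond)
  have nonempty: "?T \<noteq> {}" using tilings_card_pos[of n] by (metis card.empty less_irrefl)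
  have "black_square n (l - 1, m)"
    using assms by (auto simp: black_square_def cong_iff_dvd_diff)
  then have "placement_prob l m n = card (?T \<inter> {T. horizontal_domino l m \<in> T}) / card ?T"
    using fin nonempty by (simp add: placement_prob_def measure_pmf_of_set)
  also have "\<dots> = domino_prob n (top_side (l, m))"
    using fin by (simp add: domino_prob_def)
  also have "\<dots> = flow (int n - 1) l m / 2"
    using assms by (rule domino_prob_flow(1))
  finally show ?thesis .
qed

section \<open>Reduction to finitely many creation rates\<close>

lemma flow_descend:
  "flow t l m = flow (t - int k) l (m - int k) + (\<Sum>j<k. creation (t - int j) l (m - int j))"
proof (induction k)
  case (Suc k)
  show ?case
    using Suc flow_rec[of "t - int k" l "m - int k"] by (simp add: algebra_simps)
qed simp

text \<open>By symmetry the vertical and the horizontal two-way flow agree at the centre, so each of them is 1.\<close>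

lemma flow_centre:
  assumes "t \<ge> 0" "even t"
  shows "flow t 0 0 = (1 + creation t 0 0) / 2"
  using two_way_flow_total[of t 0 0] flow_rec[of t 0 0] assms by (simp add: two_way_flow_def)

text \<open>The total of the two-way flows at \<open>(k, 0)\<close> is 2, and by symmetry the horizontal one equals the vertical
  one at \<open>(0, k)\<close>. The latter differs from the sum of the flows through the centre at the times \<open>t - k\<close> and
  \<open>t + k\<close> by the creation rates on the vertical axis in between.\<close>

lemma flow_axis:
  assumes "int k \<le> t" "even (t + int k)"
  shows "flow t (int k) 0 = 1 / 2 + (creation t (int k) 0
    - creation (t - int k) 0 0 / 2 - creation (t + int k) 0 0 / 2
    - (\<Sum>j<k. creation (t - int j) 0 (int k - int j))
    + (\<Sum>j<Suc k. creation (t + int k - int j) 0 (- int j))) / 2"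
proof -
  have "flow t (int k) 0 = (two_way_flow t (int k) 0 + creation t (int k) 0) / 2"
    using flow_rec[of t "int k" 0] by (simp add: two_way_flow_def)
  also have "two_way_flow t (int k) 0 = 2 - two_way_flow t 0 (int k)"
    using two_way_flow_total[of t "int k" 0] assms by simp
  also have "two_way_flow t 0 (int k) = flow (t - int k) 0 0
      + (\<Sum>j<k. creation (t - int j) 0 (int k - int j))
      + (flow (t + int k) 0 0 - (\<Sum>j<Suc k. creation (t + int k - int j) 0 (- int j)))"
    using flow_descend[of t 0 "int k" k] flow_descend[of "t + int k" 0 0 "Suc k"]
    by (simp add: two_way_flow_def minus_diff_commute algebra_simps)
  also have "flow (t - int k) 0 0 = (1 + creation (t - int k) 0 0) / 2"
    using assms by (intro flow_centre) auto
  also have "flow (t + int k) 0 0 = (1 + creation (t + int k) 0 0) / 2"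
    using assms by (intro flow_centre) auto
  finally show ?thesis by (simp add: field_simps)
qed

section \<open>Creation rates as products of Krawtchouk coefficients\<close>

text \<open>Up to normalisation these are the values of the Krawtchouk polynomials.\<close>

definition krawtchouk :: "nat \<Rightarrow> nat \<Rightarrow> nat \<Rightarrow> real" where
  "krawtchouk n a b = coeff ([:1, 1:] ^ (n - b) * [:1, -1:] ^ b) a"

text \<open>On the boundary of the diamond only two neighbours contribute, and the recursion becomes
  Pascal's rule.\<close>

lemma creation_edge: "a \<le> n \<Longrightarrow> creation (int n) (int a - int n) (int a) = real (n choose a) / 2 ^ n"
proof (induction n arbitrary: a)
  case 0
  then show ?case by (simp add: creation_rec[of 0] creation_past)
next
  case (Suc n)
  let ?l = "int a - int (Suc n)" and ?t = "int (Suc n)"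
  have outside: "creation (?t - 2) ?l (int a) = 0" "creation (?t - 1) (?l - 1) (int a) = 0"
    "creation (?t - 1) ?l (int a + 1) = 0"
    using Suc.prems by (auto intro!: creation_outside)
  have up: "creation (?t - 1) (?l + 1) (int a) = real (n choose a) / 2 ^ n"
  proof (cases "a \<le> n")
    case True
    then show ?thesis using Suc.IH[of a] by (simp add: algebra_simps)
  next
    case False
    then show ?thesis using Suc.prems by (subst creation_outside) auto
  qed
  show ?case
  proof (cases a)
    case 0
    have "creation (?t - 1) ?l (int a - 1) = 0"
      using Suc.prems 0 by (auto intro!: creation_outside)
    then show ?thesis
      using outside up 0 by (subst creation_rec) simp
  next
    case (Suc c)
    have "creation (?t - 1) ?l (int a - 1) = real (n choose c) / 2 ^ n"
      using Suc.IH[of c] Suc.prems Suc by (simp add: algebra_simps)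
    then show ?thesis
      using outside up Suc by (subst creation_rec) (simp add: field_simps)
  qed
qed

lemma coeff_one_minus_power: "coeff ([:1, -1:] ^ n) a = (-1) ^ a * real (n choose a)"
  by (cases "a \<le> n") (simp_all add: coeff_linear_poly_power coeff_eq_0 degree_linear_power binomial_eq_0)

lemma coeff_one_plus_power: "coeff ([:1, 1:] ^ n) a = real (n choose a)"
  by (cases "a \<le> n") (simp_all add: coeff_linear_poly_power coeff_eq_0 degree_linear_power binomial_eq_0)

lemma krawtchouk_top: "a \<le> n \<Longrightarrow> krawtchouk n n a = (-1) ^ a"
proof -
  assume "a \<le> n"
  have "coeff ([:1, 1:] ^ (n - a) * [:1, -1:] ^ a :: real poly) ((n - a) + a)
      = coeff ([:1, 1:] ^ (n - a)) (n - a) * coeff ([:1, -1:] ^ a) a"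
    using coeff_mult_degree_sum[of "[:1, 1:] ^ (n - a)" "[:1, -1:] ^ a :: real poly"]
    by (simp add: degree_power_eq)
  then show ?thesis
    using \<open>a \<le> n\<close> by (simp add: krawtchouk_def coeff_one_minus_power coeff_one_plus_power)
qed

lemma krawtchouk_edges:
  "krawtchouk n a 0 = real (n choose a)" "krawtchouk n 0 b = 1"
  "krawtchouk n a n = (-1) ^ a * real (n choose a)"
  by (simp_all add: krawtchouk_def coeff_one_minus_power coeff_one_plus_power coeff_mult coeff_0_power)

text \<open>In the interior all factors in the recursion are combinations of six numbers: the coefficients
  \<open>x e\<close> and \<open>y e\<close> for \<open>e \<le> 2\<close> of the two polynomials that belong to size \<open>n - 2\<close>. The recursion is
  then an identity between quadratic polynomials in these numbers.\<close>

lemma creation_krawtchouk: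
  assumes "a \<le> n" "b \<le> n"
  shows "creation (int n) (int a + int b - int n) (int a - int b)
    = krawtchouk n a b * krawtchouk n b a / 2 ^ n"
  using assms
proof (induction n arbitrary: a b rule: less_induct)
  case (less n)
  consider "b = 0" | "b = n" | "a = 0" | "a = n" | "0 < a" "a < n" "0 < b" "b < n"
    using less.prems by linarith
  then show ?case
  proof cases
    case 1
    then show ?thesis using less.prems creation_edge[of a n] by (simp add: krawtchouk_edges)
  next
    case 2
    then show ?thesis
      using less.prems creation_edge[of a n] creation_swap[of "int n" "int a"]
      by (simp add: krawtchouk_edges krawtchouk_top flip: power_mult_distrib)
  next
    case 3
    then show ?thesis using less.prems creation_edge[of b n] creation_minus_right[of n _ "int b"]
      by (simp add: krawtchouk_edges)
  next
    case 4
    then show ?thesis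
      using less.prems creation_edge[of b n] creation_swap[of "int n" "int b"]
        creation_minus_right[of n "int b" "int b - int n"]
      by (simp add: krawtchouk_edges krawtchouk_top flip: power_mult_distrib)
  next
    case 5
    define i where "i = a - 1"
    define j where "j = b - 1"
    define k where "k = n - 2"
    have ij: "a = Suc i" "b = Suc j" "n = Suc (Suc k)" "i \<le> k" "j \<le> k"
      using 5 by (auto simp: i_def j_def k_def)
    define x where "x e = (if e \<le> a then coeff ([:1, 1:] ^ (k - j) * [:1, -1:] ^ j) (a - e) else 0 :: real)" for e
    define y where "y e = (if e \<le> b then coeff ([:1, 1:] ^ (k - i) * [:1, -1:] ^ i) (b - e) else 0 :: real)" for e
    let ?P = "[:1, 1:] ^ (k - j) * [:1, -1:] ^ j :: real poly"
    let ?R = "[:1, 1:] ^ (k - i) * [:1, -1:] ^ i :: real poly"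
    have split: "n - b = Suc (k - j)" "n - a = Suc (k - i)" "Suc k - j = Suc (k - j)" 
      "Suc k - i = Suc (k - i)" "Suc k - b = k - j" "Suc k - a = k - i" "Suc j = b" "Suc i = a"
      using ij by auto
    have plus: "coeff ([:1, 1:] * q) (Suc c) = coeff q (Suc c) + coeff q c"
      and minus: "coeff ([:1, -1:] * q) (Suc c) = coeff q (Suc c) - coeff q c" for q :: "real poly" and c
      by simp_all
    (* every polynomial in question is ?P or ?R times at most one factor of each kind *)
    have prods: "[:1, 1:] ^ (n - b) * [:1, -1:] ^ b = [:1, 1:] * ([:1, -1:] * ?P)"
      "[:1, 1:] ^ (n - a) * [:1, -1:] ^ a = [:1, 1:] * ([:1, -1:] * ?R)"
      "[:1, 1:] ^ (Suc k - b) * [:1, -1:] ^ b = [:1, -1:] * ?P"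
      "[:1, 1:] ^ (Suc k - a) * [:1, -1:] ^ a = [:1, -1:] * ?R"
      "[:1, 1:] ^ (Suc k - j) * [:1, -1:] ^ j = [:1, 1:] * ?P"
      "[:1, 1:] ^ (Suc k - i) * [:1, -1:] ^ i = [:1, 1:] * ?R"
      unfolding split by (simp_all only: ij(1,2) power_Suc mult_ac)
    have K: "krawtchouk n a b = x 0 - x 2" "krawtchouk (Suc k) a b = x 0 - x 1"
       "krawtchouk (Suc k) i b = x 1 - x 2" "krawtchouk (Suc k) a j = x 0 + x 1"
       "krawtchouk (Suc k) i j = x 1 + x 2" "krawtchouk k i j = x 1"
      "krawtchouk n b a = y 0 - y 2" "krawtchouk (Suc k) b a = y 0 - y 1"
       "krawtchouk (Suc k) j a = y 1 - y 2" "krawtchouk (Suc k) b i = y 0 + y 1"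
       "krawtchouk (Suc k) j i = y 1 + y 2" "krawtchouk k j i = y 1"
      unfolding krawtchouk_def prods x_def y_def using ij 
      by (cases i; cases j; simp)+
    have rec: "creation (int n) (int a + int b - int n) (int a - int b)
        = (krawtchouk (Suc k) i j * krawtchouk (Suc k) j i / 2 ^ Suc k
          + krawtchouk (Suc k) a b * krawtchouk (Suc k) b a / 2 ^ Suc k
          + krawtchouk (Suc k) i b * krawtchouk (Suc k) b i / 2 ^ Suc k
          + krawtchouk (Suc k) a j * krawtchouk (Suc k) j a / 2 ^ Suc k) / 2
          - krawtchouk k i j * krawtchouk k j i / 2 ^ k"
      using less.IH[of "Suc k" i j] less.IH[of "Suc k" a b] less.IH[of "Suc k" i b]
        less.IH[of "Suc k" a j] less.IH[of k i j] ij
      by (subst creation_rec) (simp add: algebra_simps)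
    show ?thesis
      unfolding rec K using ij(3) by (simp add: field_simps)
  qed
qed

section \<open>Rational functions of the size\<close>

definition pos_factors :: "nat \<Rightarrow> real poly" where
  "pos_factors X = (\<Prod>i=1..X. [:real i, 1:])"

definition odd_factors :: "nat \<Rightarrow> real poly" where
  "odd_factors Y = (\<Prod>j=1..Y. [:1 - 2 * real j, 2:])"

lemma degree_pos_factors: "degree (pos_factors X) = X"
  unfolding pos_factors_def by (subst degree_prod_eq_sum_degree) auto

lemma degree_odd_factors: "degree (odd_factors Y) = Y"
  unfolding odd_factors_def by (subst degree_prod_eq_sum_degree) auto

lemma pos_factors_nonzero: "pos_factors X \<noteq> 0"
  by (simp add: pos_factors_def)

lemma odd_factors_nonzero: "odd_factors Y \<noteq> 0"
  by (simp add: odd_factors_def)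

lemma poly_pos_factors_pos: "poly (pos_factors X) (real p) > 0"
  unfolding pos_factors_def poly_prod by (intro prod_pos) auto

lemma poly_odd_factors_nonzero: "poly (odd_factors Y) (real p) \<noteq> 0"
proof -
  have "1 - 2 * real j + real p * 2 \<noteq> 0" for j
  proof -
    have "1 - 2 * int j + int p * 2 \<noteq> 0" by presburger
    then have "real_of_int (1 - 2 * int j + int p * 2) \<noteq> 0" by (simp only: of_int_eq_0_iff not_False_eq_True)
    then show ?thesis by simp
  qed
  then show ?thesis by (simp add: odd_factors_def poly_prod mult.commute)
qed

text \<open>On \<open>S\<close> the function \<open>f\<close> is a rational function with denominator \<open>D\<close>. The condition on the degrees is part of the
  notion because it is inherited by sums with the same denominator.\<close>

definition rational_over :: "real poly \<Rightarrow> nat set \<Rightarrow> (nat \<Rightarrow> real) \<Rightarrow> bool" where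
  "rational_over D S f \<longleftrightarrow>
     (\<exists>Z. degree Z \<le> degree D \<and> (\<forall>p\<in>S. f p * poly D (real p) = poly Z (real p)))"

lemma rational_overI:
  assumes "degree Z \<le> degree D" "\<And>p. p \<in> S \<Longrightarrow> f p * poly D (real p) = poly Z (real p)"
  shows "rational_over D S f"
  using assms unfolding rational_over_def by blast

lemma rational_over_cong:
  "rational_over D S f \<Longrightarrow> (\<And>p. p \<in> S \<Longrightarrow> f p = g p) \<Longrightarrow> rational_over D S g"
  unfolding rational_over_def by auto

lemma rational_over_subset: "rational_over D T f \<Longrightarrow> S \<subseteq> T \<Longrightarrow> rational_over D S f"
  unfolding rational_over_def by auto

lemma rational_over_zero: "rational_over D S (\<lambda>p. 0)"
  by (rule rational_overI[of 0]) auto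

lemma rational_over_cmult:
  assumes "rational_over D S f" shows "rational_over D S (\<lambda>p. c * f p)"
proof -
  obtain Z where "degree Z \<le> degree D" "\<And>p. p \<in> S \<Longrightarrow> f p * poly D (real p) = poly Z (real p)"
    using assms unfolding rational_over_def by blast
  then show ?thesis
    by (intro rational_overI[of "smult c Z"]) (auto simp: degree_smult_eq mult.assoc)
qed

lemma rational_over_add:
  assumes "rational_over D S f" "rational_over D S g"
  shows "rational_over D S (\<lambda>p. f p + g p)"
proof -
  obtain Z W where "degree Z \<le> degree D" "\<And>p. p \<in> S \<Longrightarrow> f p * poly D (real p) = poly Z (real p)"
    "degree W \<le> degree D" "\<And>p. p \<in> S \<Longrightarrow> g p * poly D (real p) = poly W (real p)"
    using assms unfolding rational_over_def by blast
  then show ?thesis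
    by (intro rational_overI[of "Z + W"]) (auto simp: degree_add_le distrib_right)
qed

lemma rational_over_diff:
  "rational_over D S f \<Longrightarrow> rational_over D S g \<Longrightarrow> rational_over D S (\<lambda>p. f p - g p)"
  using rational_over_add[of D S f "\<lambda>p. - 1 * g p"] rational_over_cmult[of D S g "- 1"] by simp

lemma rational_over_sum:
  "(\<And>i. i \<in> I \<Longrightarrow> rational_over D S (f i)) \<Longrightarrow> rational_over D S (\<lambda>p. \<Sum>i\<in>I. f i p)"
  by (induction I rule: infinite_finite_induct)
    (simp_all add: rational_over_zero rational_over_add)

lemma rational_over_mult:
  assumes "rational_over D S f" "rational_over E S g" "D \<noteq> 0" "E \<noteq> 0"
  shows "rational_over (D * E) S (\<lambda>p. f p * g p)"
proof -
  obtain Z W where "degree Z \<le> degree D" and Z: "\<And>p. p \<in> S \<Longrightarrow> f p * poly D (real p) = poly Z (real p)"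
    and "degree W \<le> degree E" and W: "\<And>p. p \<in> S \<Longrightarrow> g p * poly E (real p) = poly W (real p)"
    using assms unfolding rational_over_def by blast
  then have "degree (Z * W) \<le> degree (D * E)"
    using degree_mult_le[of Z W] assms(3,4) by (simp add: degree_mult_eq)
  then show ?thesis
    by (rule rational_overI) (simp add: Z[symmetric] W[symmetric] mult_ac)
qed

lemma half_central_binomial: "half_central_binomial p = real (2 * p choose p) / 2"
proof (cases p)
  case (Suc q)
  have "(2 * p choose p) = 2 * (2 * p - 1 choose p)"
    using Suc binomial_symmetric[of p "2 * p - 1"] by (simp add: Suc_eq_plus1 flip: Suc_eq_plus1)
  then show ?thesis using Suc by (simp add: half_central_binomial_def)
qed (simp add: half_central_binomial_def)

lemma half_central_binomial_pos: "half_central_binomial p > 0"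
  by (simp add: half_central_binomial)

lemma central_binomial_Suc:
  "real (2 * q choose q) * (2 * (2 * real q + 1)) = real (2 * Suc q choose Suc q) * (real q + 1)"
proof -
  have "Suc q * (2 * Suc q choose Suc q) = Suc q * (2 * (Suc (2 * q) choose q))"
    using Suc_times_binomial[of q "Suc (2 * q)"] by simp
  then have twice: "(2 * Suc q choose Suc q) = 2 * (Suc (2 * q) choose q)"
    by (simp only: Suc_mult_cancel1)
  have "(Suc (2 * q) choose Suc q) = (Suc (2 * q) choose q)"
    using binomial_symmetric[of q "Suc (2 * q)"] by simp
  then have "Suc q * (Suc (2 * q) choose q) = Suc (2 * q) * (2 * q choose q)"
    using Suc_times_binomial[of q "2 * q"] by (simp only:)
  then have "Suc q * (2 * Suc q choose Suc q) = 2 * (Suc (2 * q) * (2 * q choose q))"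
    unfolding twice by (simp only: mult.left_commute)
  then have "real (Suc q * (2 * Suc q choose Suc q)) = real (2 * (Suc (2 * q) * (2 * q choose q)))"
    by (rule arg_cong)
  then show ?thesis by (simp only: of_nat_mult of_nat_Suc of_nat_numeral) (simp add: mult_ac algebra_simps)
qed

text \<open>The quotient of the central binomial coefficients for \<open>q\<close> and \<open>q + Y\<close>: half of the factors of
  \<open>(2 q + 2 Y)! / (2 q)!\<close> are even and cancel against one of the two factors \<open>(q + Y)! / q!\<close>.\<close>

lemma central_binomial_shift:
  "real (2 * q choose q) * 2 ^ Y * poly (odd_factors Y) (real (q + Y))
    = real (2 * (q + Y) choose (q + Y)) * (\<Prod>i<Y. real q + real i + 1)"
proof (induction Y arbitrary: q)
  case (Suc Y)
  have odd: "poly (odd_factors (Suc Y)) x = poly (odd_factors Y) x * (2 * x - 2 * real Y - 1)" for x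
    by (simp add: odd_factors_def algebra_simps)
  have "real (2 * q choose q) * 2 ^ Suc Y * poly (odd_factors (Suc Y)) (real (q + Suc Y))
      = (real (2 * q choose q) * (2 * (2 * real q + 1))) * 2 ^ Y * poly (odd_factors Y) (real (Suc q + Y))"
    unfolding odd by (simp add: algebra_simps)
  also have "\<dots> = (real q + 1) * (real (2 * Suc q choose Suc q) * 2 ^ Y * poly (odd_factors Y) (real (Suc q + Y)))"
    unfolding central_binomial_Suc by simp
  also have "\<dots> = (real q + 1) * (real (2 * (Suc q + Y) choose (Suc q + Y)) * (\<Prod>i<Y. real (Suc q) + real i + 1))"
    by (subst Suc.IH) rule
  also have "\<dots> = real (2 * (q + Suc Y) choose (q + Suc Y)) * (\<Prod>i<Suc Y. real q + real i + 1)"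
    by (subst prod.lessThan_Suc_shift) (simp add: algebra_simps)
  finally show ?case .
qed (simp add: odd_factors_def)

lemma off_centre_binomial:
  "real (2 * q choose (q + e)) * (\<Prod>i<e. real q + real i + 1)
    = real (2 * q choose q) * (\<Prod>i<e. real q - real i)"
proof (induction e)
  case (Suc e)
  have "real (2 * q choose (q + Suc e)) * (real q + real e + 1) = real (2 * q choose (q + e)) * (real q - real e)"
  proof (cases "e \<le> q")
    case True
    have "(2 * q choose Suc (q + e)) * Suc (q + e) = (2 * q choose (q + e)) * (2 * q - (q + e))"
      by (metis binomial_absorb_comp binomial_absorption mult.commute)
    moreover have "2 * q - (q + e) = q - e" by simp
    ultimately have "real ((2 * q choose Suc (q + e)) * Suc (q + e)) = real ((2 * q choose (q + e)) * (q - e))"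
      by presburger
    then show ?thesis using True by (simp only: of_nat_mult) (simp add: of_nat_diff algebra_simps)
  qed (simp add: binomial_eq_0)
  then have "real (2 * q choose (q + Suc e)) * (\<Prod>i<Suc e. real q + real i + 1)
      = (real (2 * q choose (q + e)) * (\<Prod>i<e. real q + real i + 1)) * (real q - real e)"
    by (simp add: mult_ac)
  then show ?case unfolding Suc.IH by simp
qed simp

text \<open>The ratio of two binomial coefficients \<open>2 (p - Y)\<close> over \<open>p - Y + e\<close> and \<open>2 p\<close> over \<open>p\<close> has \<open>Y\<close> odd
  factors in the denominator because of the smaller upper index, and \<open>e - Y\<close> factors \<open>p + i\<close> because the lower
  index exceeds \<open>p\<close> by that much. The factors \<open>p - Y + i\<close> with \<open>i \<le> Y\<close>, which vanish at small
  \<open>p\<close>, cancel completely.\<close>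

lemma off_centre_binomial_rational:
  assumes "e \<le> X + Y"
  shows "rational_over (pos_factors X * odd_factors Y) {Y..}
    (\<lambda>p. real (2 * (p - Y) choose (p - Y + e)) / half_central_binomial p)"
proof -
  define M where "M = max e Y"
  define N :: "real poly" where "N = (\<Prod>i\<in>{e..<M}. [:real i + 1 - real Y, 1:]) * (\<Prod>i<e. [:- real i - real Y, 1:])"
  define R where "R = (\<Prod>i=e - Y + 1..X. [:real i, 1:])"
  have split: "pos_factors X = pos_factors (e - Y) * R"
  proof -
    have "{1..X} = {1..e - Y} \<union> {e - Y + 1..X}" "{1..e - Y} \<inter> {e - Y + 1..X} = {}"
      using assms by auto
    then show ?thesis unfolding pos_factors_def R_def by (simp add: prod.union_disjoint)
  qed
  have "degree N = M - e + e" unfolding N_def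
    by (subst degree_mult_eq) (auto simp: degree_prod_eq_sum_degree)
  moreover have "degree R = X - (e - Y)"
    unfolding R_def by (subst degree_prod_eq_sum_degree) auto
  ultimately have deg: "degree (smult (2 / 2 ^ Y) (N * R)) \<le> degree (pos_factors X * odd_factors Y)"
    using degree_mult_le[of N R] assms
    by (auto simp: degree_mult_eq pos_factors_nonzero odd_factors_nonzero degree_pos_factors
        degree_odd_factors M_def)
  show ?thesis
  proof (rule rational_overI[OF deg])
    fix p assume "p \<in> {Y..}"
    then obtain q where p: "p = q + Y" by (metis atLeast_iff le_add_diff_inverse2)
    let ?b = "real (2 * q choose (q + e))" and ?c = "real (2 * p choose p)"
    define rise where "rise A = (\<Prod>i\<in>A. real q + real i + 1)" for A :: "nat set"
    have rise_pos: "rise A > 0" for A unfolding rise_def by (intro prod_pos) auto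
    define fall where "fall = (\<Prod>i<e. real q - real i)"
    have e_part: "?b * rise {..<e} = real (2 * q choose q) * fall"
      unfolding rise_def fall_def by (rule off_centre_binomial)
    have Y_part: "real (2 * q choose q) * 2 ^ Y * poly (odd_factors Y) (real p) = ?c * rise {..<Y}"
      unfolding p rise_def by (rule central_binomial_shift)
    (* the rising factorials occur with positive factors only, so they can be cancelled for every p \<ge> Y *)
    have both: "?b * 2 ^ Y * poly (odd_factors Y) (real p) * rise {..<e} = ?c * rise {..<Y} * fall"
    proof -
      have "?b * 2 ^ Y * poly (odd_factors Y) (real p) * rise {..<e}
          = (?b * rise {..<e}) * (2 ^ Y * poly (odd_factors Y) (real p))"
        by (simp only: mult_ac)
      also have "\<dots> = (real (2 * q choose q) * 2 ^ Y * poly (odd_factors Y) (real p)) * fall"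
        unfolding e_part by (simp only: mult_ac)
      finally show ?thesis unfolding Y_part .
    qed
    have rise_M: "rise {..<M} = rise {..<e} * rise {e..<M}" "rise {..<M} = rise {..<Y} * rise {Y..<M}"
    proof -
      have "rise {..<M} = rise {..<c} * rise {c..<M}" if "c \<le> M" for c
        using that prod.atLeastLessThan_concat[of 0 c M "\<lambda>i. real q + real i + 1"] by (simp add: rise_def lessThan_atLeast0)
      then show "rise {..<M} = rise {..<e} * rise {e..<M}" "rise {..<M} = rise {..<Y} * rise {Y..<M}"
        by (simp_all add: M_def)
    qed
    have top: "rise {Y..<M} = poly (pos_factors (e - Y)) (real p)"
    proof -
      have "rise {Y..<M} = (\<Prod>i=1..e - Y. real p + real i)"
        unfolding rise_def
        by (rule prod.reindex_bij_witness[of _ "\<lambda>i. i + Y - 1" "\<lambda>i. i + 1 - Y"])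
          (auto simp: M_def p of_nat_diff)
      then show ?thesis by (simp add: pos_factors_def poly_prod add.commute)
    qed
    have N: "poly N (real p) = rise {e..<M} * fall"
      by (simp add: N_def poly_prod rise_def fall_def p algebra_simps)
    have "?b * 2 ^ Y * poly (odd_factors Y) (real p) * rise {Y..<M} * (rise {..<e} * rise {..<Y})
        = ?c * (rise {e..<M} * fall) * (rise {..<e} * rise {..<Y})"
    proof -
      have "?b * 2 ^ Y * poly (odd_factors Y) (real p) * rise {Y..<M} * (rise {..<e} * rise {..<Y})
          = (?b * 2 ^ Y * poly (odd_factors Y) (real p) * rise {..<e}) * (rise {..<Y} * rise {Y..<M})"
        by (simp add: mult_ac)
      also have "\<dots> = ?c * rise {..<Y} * fall * (rise {..<e} * rise {e..<M})"
        unfolding both rise_M[symmetric] by simp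
      finally show ?thesis by (simp add: mult_ac)
    qed
    then have "?b * 2 ^ Y * poly (odd_factors Y) (real p) * poly (pos_factors (e - Y)) (real p)
        = ?c * poly N (real p)"
      unfolding N top using rise_pos[of "{..<e}"] rise_pos[of "{..<Y}"] by simp
    then have "?b * poly (pos_factors X * odd_factors Y) (real p) * 2 ^ Y = ?c * poly (N * R) (real p)"
      unfolding split by (simp add: mult_ac)
    then show "real (2 * (p - Y) choose (p - Y + e)) / half_central_binomial p
        * poly (pos_factors X * odd_factors Y) (real p) = poly (smult (2 / 2 ^ Y) (N * R)) (real p)"
      unfolding half_central_binomial p by (simp add: field_simps)
  qed
qed

lemma coeff_one_minus_square_power:
  "coeff ([:1, 0, -1:] ^ N :: real poly) i
    = (if even i then (-1) ^ (i div 2) * real (N choose (i div 2)) else 0)"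
proof (induction N arbitrary: i)
  case 0
  show ?case by (cases i) (auto simp: binomial_eq_0)
next
  case (Suc N)
  consider "i = 0" | "i = 1" | j where "i = Suc (Suc j)" by (metis One_nat_def not0_implies_Suc)
  then show ?case
    by cases (auto simp: Suc algebra_simps)
qed

text \<open>Expand the product with the fixed polynomial \<open>G\<close>. Every summand is a coefficient of an even power of \<open>1 - z\<^sup>2\<close>,
  that is, up to sign, a binomial coefficient at distance \<open>\<bar>d\<bar>\<close> from the centre, and the bounds on \<open>x\<close> and
  on the degree of \<open>G\<close> say that this distance is at most \<open>X + Y\<close>. The factor \<open>(-1) ^ p\<close> makes
  the sign independent of \<open>p\<close>.\<close>

lemma even_power_coeff_rational:
  fixes x :: int
  assumes x: "x \<le> 2 * int X + 1" and G: "int (degree G) \<le> x + 2 * int X + 4 * int Y + 1"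
    and S: "S \<subseteq> {Y..}" "\<And>p. p \<in> S \<Longrightarrow> 2 * int p + x \<ge> 0"
  shows "rational_over (pos_factors X * odd_factors Y) S
    (\<lambda>p. (-1) ^ p * coeff ([:1, 0, -1:] ^ (2 * (p - Y)) * G) (nat (2 * int p + x))
      / half_central_binomial p)"
proof -
  define d where "d i = (x - int i) div 2 + int Y" for i
  define s :: "nat \<Rightarrow> real" where "s i = (if even (x - int i) then (if even ((x - int i) div 2) then 1 else - 1) else 0)" for i
  have "rational_over (pos_factors X * odd_factors Y) S
    (\<lambda>p. \<Sum>i\<le>degree G. coeff G i * s i * (real (2 * (p - Y) choose (p - Y + nat \<bar>d i\<bar>)) / half_central_binomial p))"
  proof (intro rational_over_sum)
    fix i assume i: "i \<in> {..degree G}"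
    show "rational_over (pos_factors X * odd_factors Y) S
      (\<lambda>p. coeff G i * s i * (real (2 * (p - Y) choose (p - Y + nat \<bar>d i\<bar>)) / half_central_binomial p))"
    proof (cases "even (x - int i)")
      case True
      then have "2 * d i = x - int i + 2 * int Y" unfolding d_def by auto
      then have "nat \<bar>d i\<bar> \<le> X + Y" using x G i by simp
      from rational_over_subset[OF off_centre_binomial_rational[OF this] S(1)]
      show ?thesis by (rule rational_over_cmult)
    qed (simp add: s_def rational_over_zero)
  qed
  then show ?thesis
  proof (rule rational_over_cong)
    fix p assume p: "p \<in> S"
    define q where "q = p - Y"
    have pq: "int p = int q + int Y" using S(1) p by (auto simp: q_def)
    define a where "a = nat (2 * int p + x)"
    have a: "int a = 2 * int p + x" using S(2)[OF p] by (simp add: a_def)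
    let ?c = "coeff ([:1, 0, -1:] ^ (2 * q) :: real poly)"
    have "coeff ([:1, 0, -1:] ^ (2 * q) * G) a = (\<Sum>i\<le>a. coeff G i * ?c (a - i))"
      by (simp add: coeff_mult mult.commute[of _ G])
    also have "\<dots> = (\<Sum>i\<le>degree G. if i \<le> a then coeff G i * ?c (a - i) else 0)"
    proof -
      have "(\<Sum>i\<le>a. coeff G i * ?c (a - i)) = (\<Sum>i\<in>{..a} \<inter> {..degree G}. coeff G i * ?c (a - i))"
        by (rule sum.mono_neutral_right) (auto simp: coeff_eq_0)
      also have "\<dots> = (\<Sum>i\<in>{..degree G}. if i \<in> {..a} then coeff G i * ?c (a - i) else 0)"
        by (subst sum.inter_restrict[symmetric]) (auto simp: Int_commute)
      finally show ?thesis by simp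
    qed
    finally have "(-1) ^ p * coeff ([:1, 0, -1:] ^ (2 * q) * G) a
      = (\<Sum>i\<le>degree G. (-1) ^ p * (if i \<le> a then coeff G i * ?c (a - i) else 0))"
      by (simp add: sum_distrib_left)
    also have "\<dots> = (\<Sum>i\<le>degree G. coeff G i * s i * real (2 * q choose (q + nat \<bar>d i\<bar>)))"
    proof (rule sum.cong[OF refl])
      fix i
      show "(-1) ^ p * (if i \<le> a then coeff G i * ?c (a - i) else 0)
        = coeff G i * s i * real (2 * q choose (q + nat \<bar>d i\<bar>))"
      proof (cases "even (x - int i)")
        case False
        then have "s i = 0" "i \<le> a \<Longrightarrow> odd (a - i)"
          using a by (auto simp: s_def even_diff_nat) presburger+
        then show ?thesis by (auto simp: coeff_one_minus_square_power)
      next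
        case True
        then have d2: "2 * (int q + d i) = int a - int i"
          unfolding a d_def pq by auto
        show ?thesis
        proof (cases "i \<le> a")
          case False
          then have "int a < int i" by simp
          then have "d i < - int q" using d2 by (simp add: algebra_simps)
          then have "q + nat \<bar>d i\<bar> > 2 * q" by linarith
          then show ?thesis using False by (simp add: binomial_eq_0)
        next
          case ia: True
          define k where "k = nat (int q + d i)"
          have diff: "int (a - i) = 2 * (int q + d i)"
            using d2 ia by (simp add: of_nat_diff)
          then have k: "int k = int q + d i" unfolding k_def by simp
          have "int (a - i) = int (2 * k)" using diff k by simp
          then have k2: "a - i = 2 * k" by (simp only: of_nat_eq_iff)
          have "(2 * q choose k) = (2 * q choose (q + nat \<bar>d i\<bar>))"
          proof (cases "d i \<ge> 0")
            case True
            then have "k = q + nat \<bar>d i\<bar>" using k by linarith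
            then show ?thesis by simp
          next
            case False
            then have "k \<le> 2 * q" "2 * q - k = q + nat \<bar>d i\<bar>" using k by linarith+
            then show ?thesis using binomial_symmetric[of k "2 * q"] by simp
          qed
          moreover have "(-1) ^ p * (-1) ^ k = s i"
          proof -
            have "int (p + k) = 2 * int p + (x - int i) div 2"
              using k pq unfolding d_def by simp
            then have "even (p + k) \<longleftrightarrow> even ((x - int i) div 2)" by presburger
            then show ?thesis using True by (auto simp: s_def simp flip: power_add)
          qed
          ultimately show ?thesis
            using ia unfolding coeff_one_minus_square_power k2 by (simp add: mult_ac)
        qed
      qed
    qed
    finally show "(\<Sum>i\<le>degree G. coeff G i * s i * (real (2 * (p - Y) choose (p - Y + nat \<bar>d i\<bar>)) / half_central_binomial p))
      = (-1) ^ p * coeff ([:1, 0, -1:] ^ (2 * (p - Y)) * G) (nat (2 * int p + x)) / half_central_binomial p"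
      unfolding q_def a_def by (simp add: sum_divide_distrib)
  qed
qed

section \<open>Creation rates and flows as rational functions\<close>

text \<open>For \<open>a = (n + l + m) / 2\<close>, \<open>b = (n + l - m) / 2\<close> the two Krawtchouk coefficients belong to the polynomials
  \<open>(1 - z\<^sup>2)\<^sup>b (1 + z)\<^bsup>m - l\<^esup>\<close> and \<open>(1 - z\<^sup>2)\<^bsup>n - a\<^esup> (1 - z)\<^bsup>m + l\<^esup>\<close>. Each is split into an
  even power with exponent \<open>2 (p - Y)\<close> and a rest that does not depend on \<open>p\<close>; the bounds on \<open>Y\<close>
  say that the exponent of the rest is not negative. The square of \<open>(-1) ^ p\<close> disappears from the product.\<close>

lemma creation_rational_ordered:
  fixes l m X1 X2 Y1 Y2 :: nat and \<sigma> :: int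
  assumes "l \<le> m" and parity: "even (\<sigma> + int l + int m)"
    and X: "\<sigma> + int (m + l) \<le> 4 * int X1 + 2" "\<sigma> + int (m - l) \<le> 4 * int X2 + 2"
    and Y: "int (m - l) - \<sigma> \<le> 4 * int Y1" "int (m + l) - \<sigma> \<le> 4 * int Y2"
  shows "rational_over ((pos_factors X1 * odd_factors Y1) * (pos_factors X2 * odd_factors Y2))
    {max Y1 Y2..}
    (\<lambda>p. 16 ^ p / (half_central_binomial p)\<^sup>2 * creation (4 * int p + \<sigma>) (int l) (int m))"
    (is "rational_over (?D1 * ?D2) ?S _")
proof -
  define x where "x = (\<sigma> + int l + int m) div 2"
  define y where "y = (\<sigma> + int l - int m) div 2"
  have x2: "2 * x = \<sigma> + int l + int m" unfolding x_def using parity by simp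
  have y2: "2 * y = \<sigma> + int l - int m" unfolding y_def using parity by simp
  define e1 where "e1 = nat (y + 2 * int Y1)"
  define e2 where "e2 = nat (\<sigma> - x + 2 * int Y2)"
  have e1: "int e1 = y + 2 * int Y1" unfolding e1_def using y2 Y \<open>l \<le> m\<close> by simp
  have e2: "int e2 = \<sigma> - x + 2 * int Y2" unfolding e2_def using x2 Y \<open>l \<le> m\<close> by simp
  define n a b where "n p = nat (4 * int p + \<sigma>)" and "a p = nat (2 * int p + x)"
    and "b p = nat (2 * int p + y)" for p
  have nab: "int (n p) = 4 * int p + \<sigma>" "int (a p) = 2 * int p + x" "int (b p) = 2 * int p + y"
      "a p \<le> n p" "b p \<le> n p"
    if "p \<in> ?S" for p
  proof -
    have "int (m + l) - \<sigma> \<le> 4 * int p" using that Y(2) by auto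
    then have "4 * int p + \<sigma> \<ge> 0" "2 * int p + x \<ge> 0" "2 * int p + y \<ge> 0"
      "2 * int p + x \<le> 4 * int p + \<sigma>" "2 * int p + y \<le> 4 * int p + \<sigma>"
      using x2 y2 by linarith+
    then show "int (n p) = 4 * int p + \<sigma>" "int (a p) = 2 * int p + x" "int (b p) = 2 * int p + y"
      "a p \<le> n p" "b p \<le> n p"
      by (simp_all add: n_def a_def b_def)
  qed
  define G1 :: "real poly" where "G1 = [:1, 0, -1:] ^ e1 * [:1, 1:] ^ (m - l)"
  define G2 :: "real poly" where "G2 = [:1, 0, -1:] ^ e2 * [:1, -1:] ^ (m + l)"
  have degG: "degree G1 = 2 * e1 + (m - l)" "degree G2 = 2 * e2 + (m + l)"
    by (simp_all add: G1_def G2_def degree_mult_eq degree_power_eq)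
  have factor: "[:1, 1:] ^ N * [:1, -1:] ^ N = ([:1, 0, -1:] :: real poly) ^ N" for N
    by (simp flip: power_mult_distrib)
  have K1: "krawtchouk (n p) (a p) (b p) = coeff ([:1, 0, -1:] ^ (2 * (p - Y1)) * G1) (nat (2 * int p + x))"
    if "p \<in> ?S" for p
  proof -
    have "int (b p) = int (2 * (p - Y1) + e1)" "int (n p - b p) = int (b p + (m - l))"
      using nab[OF that] that e1 y2 \<open>l \<le> m\<close> by (auto simp: of_nat_diff)
    then have "b p = 2 * (p - Y1) + e1" "n p - b p = b p + (m - l)" by linarith+
    then have "[:1, 1:] ^ (n p - b p) * [:1, -1:] ^ b p = [:1, 0, -1:] ^ (2 * (p - Y1)) * G1"
      unfolding G1_def by (simp only: power_add mult_ac flip: factor)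
    then show ?thesis by (simp add: krawtchouk_def a_def)
  qed
  have K2: "krawtchouk (n p) (b p) (a p) = coeff ([:1, 0, -1:] ^ (2 * (p - Y2)) * G2) (nat (2 * int p + y))"
    if "p \<in> ?S" for p
  proof -
    have "int (n p - a p) = int (2 * (p - Y2) + e2)" "int (a p) = int (n p - a p + (m + l))"
      using nab[OF that] that e2 x2 \<open>l \<le> m\<close> by (auto simp: of_nat_diff)
    then have na: "n p - a p = 2 * (p - Y2) + e2" and a: "a p = n p - a p + (m + l)" by linarith+
    have "[:1, 1:] ^ (n p - a p) * [:1, -1:] ^ a p
        = [:1, 1:] ^ (n p - a p) * [:1, -1:] ^ (n p - a p + (m + l))"
      using a by simp
    also have "\<dots> = [:1, 0, -1:] ^ (2 * (p - Y2)) * G2"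
      unfolding G2_def na by (simp only: power_add mult_ac flip: factor)
    finally show ?thesis by (simp add: krawtchouk_def b_def)
  qed
  have "rational_over ?D1 ?S (\<lambda>p. (-1) ^ p
      * coeff ([:1, 0, -1:] ^ (2 * (p - Y1)) * G1) (nat (2 * int p + x)) / half_central_binomial p)"
  proof (rule even_power_coeff_rational)
    show "2 * int p + x \<ge> 0" if "p \<in> ?S" for p using nab[OF that] by linarith
  qed (use X Y x2 y2 e1 degG \<open>l \<le> m\<close> in \<open>auto simp: of_nat_diff\<close>)
  moreover have "rational_over ?D2 ?S (\<lambda>p. (-1) ^ p
      * coeff ([:1, 0, -1:] ^ (2 * (p - Y2)) * G2) (nat (2 * int p + y)) / half_central_binomial p)"
  proof (rule even_power_coeff_rational)
    show "2 * int p + y \<ge> 0" if "p \<in> ?S" for p using nab[OF that] by linarith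
  qed (use X Y x2 y2 e2 degG \<open>l \<le> m\<close> in \<open>auto simp: of_nat_diff\<close>)
  ultimately have "rational_over (?D1 * ?D2) ?S (\<lambda>p.
       2 powi (- \<sigma>) * (((-1) ^ p * coeff ([:1, 0, -1:] ^ (2 * (p - Y1)) * G1) (nat (2 * int p + x)) / half_central_binomial p)
     * ((-1) ^ p * coeff ([:1, 0, -1:] ^ (2 * (p - Y2)) * G2) (nat (2 * int p + y)) / half_central_binomial p)))"
    by (intro rational_over_cmult rational_over_mult) (simp_all add: pos_factors_nonzero odd_factors_nonzero)
  then show ?thesis
  proof (rule rational_over_cong)
    fix p assume p: "p \<in> ?S"
    note nab = nab[OF p]
    have "creation (4 * int p + \<sigma>) (int l) (int m) = creation (int (n p)) (int (a p) + int (b p) - int (n p)) (int (a p) - int (b p))"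
    proof -
      have "x + y - \<sigma> = int l" "x - y = int m" using x2 y2 by linarith+
      then show ?thesis using nab by (simp add: algebra_simps)
    qed
    also have "\<dots> = krawtchouk (n p) (a p) (b p) * krawtchouk (n p) (b p) (a p) / 2 ^ n p"
      using nab by (intro creation_krawtchouk) auto
    also have "(2 :: real) ^ n p = 2 powi (4 * int p + \<sigma>)"
      using nab(1) by (metis power_int_of_nat)
    also have "\<dots> = 16 ^ p * 2 powi \<sigma>"
      by (simp add: power_int_add power_int_mult)
    finally have c: "creation (4 * int p + \<sigma>) (int l) (int m)
      = krawtchouk (n p) (a p) (b p) * krawtchouk (n p) (b p) (a p) / (16 ^ p * 2 powi \<sigma>)" .
    have sign: "(-1 :: real) ^ p * (-1) ^ p = 1" by (simp flip: power_mult_distrib)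
    show "2 powi (- \<sigma>) * (((-1) ^ p * coeff ([:1, 0, -1:] ^ (2 * (p - Y1)) * G1) (nat (2 * int p + x)) / half_central_binomial p)
     * ((-1) ^ p * coeff ([:1, 0, -1:] ^ (2 * (p - Y2)) * G2) (nat (2 * int p + y)) / half_central_binomial p))
     = 16 ^ p / (half_central_binomial p)\<^sup>2 * creation (4 * int p + \<sigma>) (int l) (int m)"
      unfolding c K1[OF p] K2[OF p] using half_central_binomial_pos[of p] sign
      by (simp add: field_simps power2_eq_square power_int_minus)
  qed
qed

lemma creation_rational:
  fixes l m \<sigma> :: int
  assumes X: "\<sigma> + \<bar>l\<bar> + \<bar>m\<bar> \<le> 4 * int X1 + 2" "\<sigma> + \<bar>\<bar>l\<bar> - \<bar>m\<bar>\<bar> \<le> 4 * int X2 + 2"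
    and Y: "\<bar>l\<bar> + \<bar>m\<bar> - \<sigma> \<le> 4 * int Y1" "\<bar>\<bar>l\<bar> - \<bar>m\<bar>\<bar> - \<sigma> \<le> 4 * int Y2"
  shows "rational_over (pos_factors X1 * pos_factors X2 * odd_factors Y1 * odd_factors Y2)
    {max Y1 Y2..} (\<lambda>p. 16 ^ p / (half_central_binomial p)\<^sup>2 * creation (4 * int p + \<sigma>) l m)"
proof (cases "even (\<sigma> + l + m)")
  case False
  then show ?thesis by (simp add: creation_odd rational_over_zero)
next
  case True
  define l' m' where "l' = nat (min \<bar>l\<bar> \<bar>m\<bar>)" and "m' = nat (max \<bar>l\<bar> \<bar>m\<bar>)"
  have "creation t l m = creation t (int l') (int m')" for t
    using creation_abs[of t l m] creation_swap[of t "\<bar>l\<bar>" "\<bar>m\<bar>"]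
    by (auto simp: l'_def m'_def min_def max_def)
  moreover have "even (\<sigma> + int l' + int m')"
    using True by (auto simp: l'_def m'_def min_def max_def)
  moreover have "int (m' + l') = \<bar>l\<bar> + \<bar>m\<bar>" "int (m' - l') = \<bar>\<bar>l\<bar> - \<bar>m\<bar>\<bar>" "l' \<le> m'"
    by (auto simp: l'_def m'_def min_def max_def)
  ultimately show ?thesis
    using creation_rational_ordered[of l' m' \<sigma> X1 X2 Y2 Y1] X Y
    by (simp add: mult_ac max.commute)
qed

text \<open>The parity makes rounding cost at most 2 instead of 3. Both this and the next lemma are used for counting
  linear factors.\<close>

lemma quarter_below: "even z \<Longrightarrow> 0 \<le> z \<Longrightarrow> \<exists>X :: nat. 4 * int X \<le> z \<and> z \<le> 4 * int X + 2"
  by (rule exI[of _ "nat (z div 4)"]) (auto; presburger)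

lemma quarter_above: "even z \<Longrightarrow> - 2 \<le> z \<Longrightarrow> \<exists>Y :: nat. z \<le> 4 * int Y \<and> 4 * int Y \<le> z + 2"
  by (rule exI[of _ "nat ((z + 2) div 4)"]) (auto; presburger)

lemma flow_axis_rational:
  fixes k :: nat and \<tau> u :: int
  defines "w \<equiv> \<lambda>p. 16 ^ p / (half_central_binomial p)\<^sup>2"
  assumes parity: "even (\<tau> + u + int k)" and S: "\<And>p. p \<in> S \<Longrightarrow> int k \<le> 4 * int p + \<tau> + u"
    and axis: "rational_over D S (\<lambda>p. w p * creation (4 * int p + (\<tau> + u)) (int k) 0)"
    and down: "\<And>j. j \<le> k \<Longrightarrow> rational_over D S (\<lambda>p. w p * creation (4 * int p + (\<tau> + u - int j)) 0 (int k - int j))"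
    and up: "\<And>j. j \<le> k \<Longrightarrow> rational_over D S (\<lambda>p. w p * creation (4 * int p + (\<tau> + u + int k - int j)) 0 (- int j))"
  shows "rational_over D S (\<lambda>p. w p * (flow (4 * int p + \<tau> + u) (int k) 0 - 1 / 2))"
proof -
  let ?c = "\<lambda>p v i j. w p * creation (4 * int p + (\<tau> + v)) i j"
  have "rational_over D S (\<lambda>p. (1 / 2) * (?c p u (int k) 0 - (1 / 2) * ?c p (u - int k) 0 0
      - (1 / 2) * ?c p (u + int k) 0 0
      - (\<Sum>j<k. ?c p (u - int j) 0 (int k - int j))
      + (\<Sum>j<Suc k. ?c p (u + int k - int j) 0 (- int j))))"
    using axis down up down[of k] up[of 0]
    by (intro rational_over_cmult rational_over_diff rational_over_add rational_over_sum)
      (simp_all add: algebra_simps)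
  then show ?thesis
  proof (rule rational_over_cong)
    fix p assume p: "p \<in> S"
    show "(1 / 2) * (?c p u (int k) 0 - (1 / 2) * ?c p (u - int k) 0 0
      - (1 / 2) * ?c p (u + int k) 0 0
      - (\<Sum>j<k. ?c p (u - int j) 0 (int k - int j))
      + (\<Sum>j<Suc k. ?c p (u + int k - int j) 0 (- int j)))
      = w p * (flow (4 * int p + \<tau> + u) (int k) 0 - 1 / 2)"
      using S[OF p] parity
      by (subst flow_axis) (simp_all add: sum_distrib_left algebra_simps)
  qed
qed

text \<open>Put \<open>a = \<bar>l\<bar> + \<bar>m\<bar>\<close> and \<open>d = \<bar>\<bar>l\<bar> - \<bar>m\<bar>\<bar>\<close>. All creation rates that contribute to the flow have common
  denominators with, up to rounding, the following numbers of factors: for \<open>m \<ge> 0\<close>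
  there are \<open>(a + \<tau>) / 4\<close> and \<open>(d + \<tau>) / 4\<close> factors of the form \<open>p + i\<close> and twice \<open>(a - \<tau>) / 4\<close> odd ones;
  for \<open>m < 0\<close> there are twice \<open>(a + \<tau>) / 4\<close> factors \<open>p + i\<close>, and
  \<open>(a - \<tau>) / 4\<close> and \<open>(d - \<tau>) / 4\<close> odd ones. In both cases the sum is \<open>(3 a + d) / 4\<close>, the maximum plus half
  of the minimum of \<open>\<bar>l\<bar>\<close> and \<open>\<bar>m\<bar>\<close>, and rounding adds at most 1.\<close>

lemma flow_rational:
  fixes l m \<tau> :: int
  assumes \<tau>: "- 1 \<le> \<tau>" "\<tau> \<le> 2" and parity: "even (\<tau> + l + m)"
  obtains X1 X2 Y1 Y2 :: nat
  where "2 * int (X1 + X2 + Y1 + Y2) \<le> 2 * max \<bar>l\<bar> \<bar>m\<bar> + min \<bar>l\<bar> \<bar>m\<bar> + 2"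
    "rational_over (pos_factors X1 * pos_factors X2 * odd_factors Y1 * odd_factors Y2)
      {p. \<bar>l\<bar> + \<bar>m\<bar> \<le> 4 * int p + \<tau>}
      (\<lambda>p. 16 ^ p / (half_central_binomial p)\<^sup>2 * (flow (4 * int p + \<tau>) l m - 1 / 2))"
proof -
  define k r where "k = nat \<bar>l\<bar>" and "r = nat \<bar>m\<bar>"
  have k: "\<bar>l\<bar> = int k" and r: "\<bar>m\<bar> = int r" by (simp_all add: k_def r_def)
  let ?S = "{p. int k + int r \<le> 4 * int p + \<tau>}"
  define d where "d = \<bar>int k - int r\<bar>"
  have d_nonneg: "d \<ge> 0" by (simp add: d_def)
  have d: "int k + int r + d = 2 * max (int k) (int r)" "2 * min (int k) (int r) = int k + int r - d"
    by (auto simp: d_def)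
  have even: "even (\<tau> + int k + int r)" using parity k r by presburger
  then have even_d: "even (d + \<tau>)" "even (d - \<tau>)" and even_s: "even (int k + int r + \<tau>)" "even (int k + int r - \<tau>)"
    unfolding d_def by presburger+
  have "0 \<le> int k + int r + \<tau>" "0 \<le> d + \<tau>" using even_s even_d \<tau> by (presburger add: d_def)+
  (* X1 and X count factors p + i, Y1 and Y count odd factors *)
  obtain X1 where X1: "4 * int X1 \<le> int k + int r + \<tau>" "int k + int r + \<tau> \<le> 4 * int X1 + 2"
    using quarter_below even_s \<open>0 \<le> int k + int r + \<tau>\<close> by blast
  obtain X where X: "4 * int X \<le> d + \<tau>" "d + \<tau> \<le> 4 * int X + 2"
    using quarter_below even_d \<open>0 \<le> d + \<tau>\<close> by blast
  obtain Y1 where Y1: "int k + int r - \<tau> \<le> 4 * int Y1" "4 * int Y1 \<le> int k + int r - \<tau> + 2"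
    using quarter_above[of "int k + int r - \<tau>"] even_s \<tau> by auto
  obtain Y where Y: "d - \<tau> \<le> 4 * int Y" "4 * int Y \<le> d - \<tau> + 2"
    using quarter_above[OF even_d(2)] \<tau> d_nonneg by auto
  define w where "w p = 16 ^ p / (half_central_binomial p)\<^sup>2" for p
  have term_rational: "rational_over (pos_factors X1 * pos_factors X2 * odd_factors Y1 * odd_factors Y2) ?S
      (\<lambda>p. w p * creation (4 * int p + \<sigma>) i j)"
    if "\<sigma> + \<bar>i\<bar> + \<bar>j\<bar> \<le> 4 * int X1 + 2" "\<sigma> + \<bar>\<bar>i\<bar> - \<bar>j\<bar>\<bar> \<le> 4 * int X2 + 2"
      "\<bar>i\<bar> + \<bar>j\<bar> - \<sigma> \<le> 4 * int Y1" "\<bar>\<bar>i\<bar> - \<bar>j\<bar>\<bar> - \<sigma> \<le> 4 * int Y2"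
      "Y2 \<in> {Y, Y1}" for \<sigma> i j X2 Y2
    unfolding w_def
    by (rule rational_over_subset[OF creation_rational[OF that(1-4)]])
      (use that(5) Y Y1 in \<open>auto simp: d_def\<close>)
  show thesis
  proof (cases "m \<ge> 0")
    case True
    then have m: "m = int r" using r by simp
    let ?D = "pos_factors X1 * pos_factors X * odd_factors Y1 * odd_factors Y1"
    have "rational_over ?D ?S (\<lambda>p. w p * (flow (4 * int p + \<tau> + - int r) (int k) 0 - 1 / 2))"
      unfolding w_def
      by (rule flow_axis_rational; (fold w_def)?; (rule term_rational)?)
        (use X1 X Y1 even in \<open>auto simp: d_def\<close>)
    moreover have "rational_over ?D ?S (\<lambda>p. \<Sum>j<r. w p * creation (4 * int p + (\<tau> - int j)) (int k) (int r - int j))"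
      by (rule rational_over_sum, rule term_rational) (use X1 X Y1 in \<open>auto simp: d_def\<close>)
    ultimately have "rational_over ?D ?S (\<lambda>p. w p * (flow (4 * int p + \<tau> + - int r) (int k) 0 - 1 / 2)
        + (\<Sum>j<r. w p * creation (4 * int p + (\<tau> - int j)) (int k) (int r - int j)))"
      by (rule rational_over_add)
    then have "rational_over ?D ?S (\<lambda>p. w p * (flow (4 * int p + \<tau>) (int k) m - 1 / 2))"
    proof (rule rational_over_cong)
      fix p
      have "flow (4 * int p + \<tau>) (int k) m = flow (4 * int p + \<tau> + - int r) (int k) 0
          + (\<Sum>j<r. creation (4 * int p + (\<tau> - int j)) (int k) (int r - int j))"
        using flow_descend[of "4 * int p + \<tau>" "int k" m r] m by (simp add: add_diff_eq)
      then show "w p * (flow (4 * int p + \<tau> + - int r) (int k) 0 - 1 / 2)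
        + (\<Sum>j<r. w p * creation (4 * int p + (\<tau> - int j)) (int k) (int r - int j))
        = w p * (flow (4 * int p + \<tau>) (int k) m - 1 / 2)"
        by (simp only:) (simp add: algebra_simps flip: sum_distrib_left)
    qed
    then show thesis
      using that[of X1 X Y1 Y1] X1 X Y1 d unfolding k r w_def
      by (simp add: flow_abs_left[of _ l, unfolded k])
  next
    case False
    then have m: "m = - int r" using r by simp
    let ?D = "pos_factors X1 * pos_factors X1 * odd_factors Y1 * odd_factors Y"
    have "rational_over ?D ?S (\<lambda>p. w p * (flow (4 * int p + \<tau> + int r) (int k) 0 - 1 / 2))"
      unfolding w_def
      by (rule flow_axis_rational; (fold w_def)?; (rule term_rational)?)
        (use X1 Y Y1 even in \<open>auto simp: d_def\<close>)
    moreover have "rational_over ?D ?S (\<lambda>p. \<Sum>j<r. w p * creation (4 * int p + (\<tau> + int r - int j)) (int k) (- int j))"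
      by (rule rational_over_sum, rule term_rational) (use X1 Y Y1 in \<open>auto simp: d_def\<close>)
    ultimately have "rational_over ?D ?S (\<lambda>p. w p * (flow (4 * int p + \<tau> + int r) (int k) 0 - 1 / 2)
        - (\<Sum>j<r. w p * creation (4 * int p + (\<tau> + int r - int j)) (int k) (- int j)))"
      by (rule rational_over_diff)
    then have "rational_over ?D ?S (\<lambda>p. w p * (flow (4 * int p + \<tau>) (int k) m - 1 / 2))"
    proof (rule rational_over_cong)
      fix p
      have "flow (4 * int p + \<tau>) (int k) m = flow (4 * int p + \<tau> + int r) (int k) 0
          - (\<Sum>j<r. creation (4 * int p + (\<tau> + int r - int j)) (int k) (- int j))"
        using flow_descend[of "4 * int p + \<tau> + int r" "int k" 0 r] m
        by (simp add: add_diff_eq add.assoc)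
      then show "w p * (flow (4 * int p + \<tau> + int r) (int k) 0 - 1 / 2)
        - (\<Sum>j<r. w p * creation (4 * int p + (\<tau> + int r - int j)) (int k) (- int j))
        = w p * (flow (4 * int p + \<tau>) (int k) m - 1 / 2)"
        by (simp only:) (simp add: algebra_simps flip: sum_distrib_left)
    qed
    then show thesis
      using that[of X1 X1 Y1 Y] X1 Y Y1 d unfolding k r w_def
      by (simp add: flow_abs_left[of _ l, unfolded k])
  qed
qed

section \<open>The placement probabilities near the centre\<close>

lemma explicit_product_factors:
  "explicit_product (pos_factors X1 * pos_factors X2 * odd_factors Y1 * odd_factors Y2)"
  unfolding explicit_product_def
proof (intro exI conjI)
  let ?I = "mset_set {1..X1} + mset_set {1..X2}" and ?J = "mset_set {1..Y1} + mset_set {1..Y2}"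
  show "\<forall>i\<in>#?I. 1 \<le> i" "\<forall>j\<in>#?J. 1 \<le> j" by auto
  show "pos_factors X1 * pos_factors X2 * odd_factors Y1 * odd_factors Y2
    = (\<Prod>i\<in>#?I. [:real i, 1:]) * (\<Prod>j\<in>#?J. [:1 - 2 * real j, 2:])"
    by (simp add: pos_factors_def odd_factors_def prod_unfold_prod_mset)
qed

text \<open>With \<open>n = 4 * p + \<tau> + 1\<close> the conclusion is the range of \<open>p\<close> in \<open>flow_rational\<close>, so the formula obtained there
  applies whenever the domino lies in the diamond.\<close>

lemma domino_in_aztec_diamond:
  assumes "horizontal_domino l m \<subseteq> aztec_diamond n" "odd (l + m + int n)"
  shows "\<bar>l\<bar> + \<bar>m\<bar> \<le> int n - 1"
proof -
  have "\<bar>2 * (l - 1) + 1\<bar> + \<bar>2 * m + 1\<bar> \<le> 2 * int n" "\<bar>2 * l + 1\<bar> + \<bar>2 * m + 1\<bar> \<le> 2 * int n"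
    using assms(1) by (simp_all add: horizontal_domino_def aztec_diamond_iff)
  then have "\<bar>l\<bar> + \<bar>m\<bar> \<le> int n" by (cases "0 \<le> l"; cases "0 \<le> m"; simp)
  moreover have "\<bar>l\<bar> + \<bar>m\<bar> \<noteq> int n"
  proof
    assume "\<bar>l\<bar> + \<bar>m\<bar> = int n"
    then have "even (\<bar>l\<bar> + \<bar>m\<bar> + int n)" by simp
    then show False using assms(2) by simp
  qed
  ultimately show ?thesis by linarith
qed

theorem theorem1p2:
  fixes l m :: int and \<alpha> :: nat
  assumes "\<alpha> \<in> {0, 1, 2, 3}"
    and "[l + m = int \<alpha> + 1] (mod 2)"
  shows "\<exists>Z D :: real poly.
    (\<forall>p::nat. horizontal_domino l m \<subseteq> aztec_diamond (4 * p + \<alpha>) \<longrightarrow>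
       placement_prob l m (4 * p + \<alpha>) =
         1 / 4 + 2 powi (- 4 * int p - int \<alpha>) * (half_central_binomial p)\<^sup>2 *
           (poly Z (real p) / poly D (real p))) \<and>
    degree Z \<le> degree D \<and>
    int (degree D) \<le> max \<bar>l\<bar> \<bar>m\<bar> + \<lfloor>real_of_int (min (\<bar>l\<bar> + 3) \<bar>m\<bar>) / 2\<rfloor> + 1 \<and>
    explicit_product D"
proof -
  (* dominoes at size n correspond to flows at time n - 1 *)
  define \<tau> where "\<tau> = int \<alpha> - 1"
  have odd: "odd (l + m + int \<alpha>)"
    using assms(2) by (auto simp: cong_iff_dvd_diff)
  then have parity: "even (\<tau> + l + m)" by (auto simp: \<tau>_def)
  have \<tau>: "- 1 \<le> \<tau>" "\<tau> \<le> 2" using assms(1) by (auto simp: \<tau>_def)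
  obtain X1 X2 Y1 Y2 :: nat
    where size: "2 * int (X1 + X2 + Y1 + Y2) \<le> 2 * max \<bar>l\<bar> \<bar>m\<bar> + min \<bar>l\<bar> \<bar>m\<bar> + 2"
      and rational: "rational_over (pos_factors X1 * pos_factors X2 * odd_factors Y1 * odd_factors Y2)
        {p. \<bar>l\<bar> + \<bar>m\<bar> \<le> 4 * int p + \<tau>}
        (\<lambda>p. 16 ^ p / (half_central_binomial p)\<^sup>2 * (flow (4 * int p + \<tau>) l m - 1 / 2))"
    using flow_rational[OF \<tau> parity] by blast
  define D where "D = pos_factors X1 * pos_factors X2 * odd_factors Y1 * odd_factors Y2"
  obtain Z where Z: "degree Z \<le> degree D"
    "\<And>p. \<bar>l\<bar> + \<bar>m\<bar> \<le> 4 * int p + \<tau> \<Longrightarrow>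
      16 ^ p / (half_central_binomial p)\<^sup>2 * (flow (4 * int p + \<tau>) l m - 1 / 2) * poly D (real p)
        = poly Z (real p)"
    using rational unfolding rational_over_def D_def by blast
  have degree: "degree D = X1 + X2 + Y1 + Y2"
    by (simp add: D_def degree_mult_eq pos_factors_nonzero odd_factors_nonzero
        degree_pos_factors degree_odd_factors)
  have half: "\<lfloor>real_of_int k / 2\<rfloor> = k div 2" for k
    using floor_divide_of_int_eq[of k 2] by simp
  have "placement_prob l m (4 * p + \<alpha>) = 1 / 4 + 2 powi (- 4 * int p - int \<alpha>)
      * (half_central_binomial p)\<^sup>2 * (poly (smult (2 ^ \<alpha> / 2) Z) (real p) / poly D (real p))"
    if inside: "horizontal_domino l m \<subseteq> aztec_diamond (4 * p + \<alpha>)" for p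
  proof -
    have odd_p: "odd (l + m + int (4 * p + \<alpha>))" using odd by simp
    then have "\<bar>l\<bar> + \<bar>m\<bar> \<le> 4 * int p + \<tau>"
      using domino_in_aztec_diamond[OF inside] by (simp add: \<tau>_def)
    note Z = Z(2)[OF this]
    have "placement_prob l m (4 * p + \<alpha>) = flow (4 * int p + \<tau>) l m / 2"
      using placement_prob_flow[OF odd_p] by (simp add: \<tau>_def add_diff_eq)
    also have "\<dots> = 1 / 4 + (flow (4 * int p + \<tau>) l m - 1 / 2) / 2"
      by (simp add: field_simps)
    finally have prob: "placement_prob l m (4 * p + \<alpha>) = 1 / 4 + (flow (4 * int p + \<tau>) l m - 1 / 2) / 2" .
    have D_nonzero: "poly D (real p) \<noteq> 0"
      using poly_pos_factors_pos[of X1 p] poly_pos_factors_pos[of X2 p]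
        poly_odd_factors_nonzero[of Y1 p] poly_odd_factors_nonzero[of Y2 p]
      by (simp add: D_def)
    have power: "(2 :: real) powi (- 4 * int p - int \<alpha>) = 1 / (16 ^ p * 2 ^ \<alpha>)"
    proof -
      have "(2 :: real) powi (- 4 * int p - int \<alpha>) = inverse (2 powi int (4 * p + \<alpha>))"
        by (simp flip: power_int_minus)
      then show ?thesis by (simp only: power_int_of_nat power_add power_mult) (simp add: field_simps)
    qed
    have "1 / (w * a) * h\<^sup>2 * (a / 2 * (w / h\<^sup>2 * x * d) / d) = x / 2"
      if "w \<noteq> 0" "a \<noteq> 0" "h \<noteq> 0" "d \<noteq> 0" for w a h d x :: real
      using that by simp
    from this[of "16 ^ p" "2 ^ \<alpha>" "half_central_binomial p" "poly D (real p)"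
        "flow (4 * int p + \<tau>) l m - 1 / 2"]
    have ratio: "1 / (16 ^ p * 2 ^ \<alpha>) * (half_central_binomial p)\<^sup>2
        * (2 ^ \<alpha> / 2 * poly Z (real p) / poly D (real p)) = (flow (4 * int p + \<tau>) l m - 1 / 2) / 2"
      unfolding Z using half_central_binomial_pos[of p] D_nonzero by simp
    show ?thesis
      unfolding prob power ratio[symmetric] by simp
  qed
  moreover have "degree (smult (2 ^ \<alpha> / 2) Z) \<le> degree D" using Z(1) by simp
  moreover have "int (degree D) \<le> max \<bar>l\<bar> \<bar>m\<bar> + \<lfloor>real_of_int (min (\<bar>l\<bar> + 3) \<bar>m\<bar>) / 2\<rfloor> + 1"
  proof -
    have "s \<le> x + b div 2 + 1" if "2 * s \<le> 2 * x + a + 2" "a \<le> b" for s x a b :: int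
      using that by presburger
    moreover have "min \<bar>l\<bar> \<bar>m\<bar> \<le> min (\<bar>l\<bar> + 3) \<bar>m\<bar>" by (rule min.mono) simp_all
    ultimately show ?thesis unfolding half degree using size by blast
  qed
  moreover have "explicit_product D" unfolding D_def by (rule explicit_product_factors)
  ultimately show ?thesis by blast
qed

end
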